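(* Let $K$ be a field and let $P\subset\mathbb{R}^d$ be a smooth lattice polytope with toric ideal $I(P)$. Then the following are equivalent: (1) $I(P)$ is scheme-theoretically generated in degree $2$; (2) both of the following conditions hold: (a) for every vertex $v$ of $P$ and every lattice point $x\in P\cap\mathbb{Z}^d$ with $x\neq v$ that is not a neighbor of $v$, the polytope $P\cap(x+v-P)$ contains a lattice point $y$ with $y\neq v$ and $y\neq x$; and (b) every lattice point $x\in P\cap\mathbb{Z}^d$ that is not a vertex of $P$ is the midpoint of a line segment $[y,z]$ with $y,z\in P\cap\mathbb{Z}^d$ and $y,z\neq x$.
   Context: A lattice polytope $P\subset\mathbb{R}^d$ is the convex hull of finitely many points of $\mathbb{Z}^d$. It is called smooth if it has dimension $d$, exactly $d$ edges emanate from each vertex $v$, and the $d$ vectors $w-v$, where $w$ runs through the lattice points next to $v$ on the edges containing $v$, form a basis of $\mathbb{Z}^d$. The lattice points $w$ next to a vertex $v$ on an edge of $P$ are called the neighbors of $v$. The notation $x+v-P$ means $\{x+v-p : p\in P\}$. Let $M(P)$ be the submonoid of $\mathbb{Z}^{d+1}$ generated by $(P\times\{1\})\cap\mathbb{Z}^{d+1}$, and $K[M(P)]$ its monoid algebra. Let $A_P=K[X_x : x\in P\cap\mathbb{Z}^d]$ be the polynomial ring with its standard grading. The toric ideal $I(P)$ is the kernel of the $K$-algebra homomorphism $A_P\to K[M(P)]$ that sends $X_x$ to the monoid element $(x,1)\in M(P)\subset K[M(P)]$. A homogeneous ideal $I$ in a standard graded polynomial ring $A=K[X_1,\dots,X_n]$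 is scheme-theoretically generated in degree $2$ if there exists an ideal $J\subset A$ generated by homogeneous elements of degree $2$ such that $I^{\mathrm{sat}}=J^{\mathrm{sat}}$. Here, with $\mathfrak{m}=(X_1,\dots,X_n)$, one sets $I^{\mathrm{sat}}=\{f\in A : \mathfrak{m}^k f\subset I \text{ for some } k\}$. *)

theory Defs
  imports
    "HOL-Analysis.Analysis"
    "HOL-Library.Poly_Mapping"
    "HOL-Algebra.RingHom"
    "HOL-Algebra.Ideal_Product"
begin

section \<open>Smooth lattice polytopes\<close>

text \<open>In \<^typ>\<open>real ^ 'n\<close> this is the lattice of integral points, and in
  \<^typ>\<open>(real ^ 'n) \<times> real\<close> the one of rank one more.\<close>

definition int_lattice :: "'a::euclidean_space set" where
  "int_lattice = {x. \<forall>b\<in>Basis. x \<bullet> b \<in> \<int>}"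

lemma int_lattice_vec_iff: "(x :: real ^ 'n) \<in> int_lattice \<longleftrightarrow> (\<forall>i. x $ i \<in> \<int>)"
  by (auto simp: int_lattice_def Basis_vec_def inner_axis)

lemma int_lattice_Pair_iff:
  "(x, t :: real) \<in> int_lattice \<longleftrightarrow> x \<in> int_lattice \<and> t \<in> \<int>"
  by (auto simp: int_lattice_def Basis_prod_def)

global_interpretation int_module:
  module "(\<lambda>k x. of_int k *\<^sub>R x) :: int \<Rightarrow> 'a \<Rightarrow> 'a::real_vector"
  by standard (simp_all add: algebra_simps)

definition lattice_basis :: "'a::euclidean_space set \<Rightarrow> bool" where
  "lattice_basis B \<longleftrightarrow> int_module.independent B \<and> int_module.span B = int_lattice"

definition lattice_polytope :: "'a::euclidean_space set \<Rightarrow> bool" where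
  "lattice_polytope P \<longleftrightarrow> (\<exists>S. finite S \<and> S \<subseteq> int_lattice \<and> P = convex hull S)"

definition neighbors :: "'a::euclidean_space set \<Rightarrow> 'a \<Rightarrow> 'a set" where
  "neighbors P v =
    {w. \<exists>E. E edge_of P \<and> v \<in> E \<and> w \<in> E \<inter> int_lattice \<and> w \<noteq> v \<and>
        open_segment v w \<inter> int_lattice = {}}"

definition smooth_lattice_polytope :: "'a::euclidean_space set \<Rightarrow> bool" where
  "smooth_lattice_polytope P \<longleftrightarrow>
    lattice_polytope P \<and> aff_dim P = int DIM('a) \<and>
    (\<forall>v. v extreme_point_of P \<longrightarrow>
      card {E. E edge_of P \<and> v \<in> E} = DIM('a) \<and>
      lattice_basis ((\<lambda>w. w - v) ` neighbors P v))"

section \<open>Monoid algebras and polynomial rings\<close>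

definition monoid_algebra ::
    "'m::comm_monoid_add set \<Rightarrow> ('m \<Rightarrow>\<^sub>0 'k::comm_ring_1) ring" where
  "monoid_algebra M =
    \<lparr>carrier = {f. Poly_Mapping.keys f \<subseteq> M}, mult = (*), one = 1, zero = 0, add = (+)\<rparr>"

definition is_submonoid :: "'m::comm_monoid_add set \<Rightarrow> bool" where
  "is_submonoid M \<longleftrightarrow> 0 \<in> M \<and> (\<forall>a\<in>M. \<forall>b\<in>M. a + b \<in> M)"

text \<open>A monomial in variables from \<open>V\<close> is a finitely supported exponent function, so the
  polynomial ring with variables \<open>V\<close> is the algebra of the free commutative monoid on \<open>V\<close>.\<close>

definition monomials :: "'x set \<Rightarrow> ('x \<Rightarrow>\<^sub>0 nat) set" where
  "monomials V = {m. Poly_Mapping.keys m \<subseteq> V}"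

abbreviation poly_ring :: "'x set \<Rightarrow> (('x \<Rightarrow>\<^sub>0 nat) \<Rightarrow>\<^sub>0 'k::comm_ring_1) ring" where
  "poly_ring V \<equiv> monoid_algebra (monomials V)"

definition poly_var :: "'x \<Rightarrow> ('x \<Rightarrow>\<^sub>0 nat) \<Rightarrow>\<^sub>0 'k::comm_ring_1" where
  "poly_var x = Poly_Mapping.single (Poly_Mapping.single x 1) 1"

lemma monoid_algebra_simps [simp]:
  "carrier (monoid_algebra M) = {f. Poly_Mapping.keys f \<subseteq> M}"
  "mult (monoid_algebra M) = (*)"
  "one (monoid_algebra M) = 1"
  "zero (monoid_algebra M) = 0"
  "add (monoid_algebra M) = (+)"
  by (simp_all add: monoid_algebra_def)

lemma monoid_algebra_cring:
  assumes "is_submonoid M"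
  shows "cring (monoid_algebra M :: ('m::comm_monoid_add \<Rightarrow>\<^sub>0 'k::comm_ring_1) ring)"
proof (rule cringI)
  let ?R = "monoid_algebra M :: ('m \<Rightarrow>\<^sub>0 'k) ring"
  have mult: "Poly_Mapping.keys (f * g) \<subseteq> M"
    if "Poly_Mapping.keys f \<subseteq> M" "Poly_Mapping.keys g \<subseteq> M" for f g :: "'m \<Rightarrow>\<^sub>0 'k"
    using keys_mult[of f g] that assms unfolding is_submonoid_def by blast
  have add: "Poly_Mapping.keys (f + g) \<subseteq> M"
    if "Poly_Mapping.keys f \<subseteq> M" "Poly_Mapping.keys g \<subseteq> M" for f g :: "'m \<Rightarrow>\<^sub>0 'k"
    using keys_add[of f g] that by blast
  have zero: "0 \<in> M"
    using assms by (simp add: is_submonoid_def)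
  show "abelian_group ?R"
  proof (rule abelian_groupI)
    fix f assume "f \<in> carrier ?R"
    then show "\<exists>g\<in>carrier ?R. g \<oplus>\<^bsub>?R\<^esub> f = \<zero>\<^bsub>?R\<^esub>"
      by (intro bexI[of _ "- f"]) simp_all
  qed (simp_all add: add ac_simps)
  show "comm_monoid ?R"
    by (intro comm_monoidI) (simp_all add: mult zero ac_simps)
qed (simp add: algebra_simps)

lemma is_submonoid_monomials: "is_submonoid (monomials V)"
proof -
  have "Poly_Mapping.keys (a + b) \<subseteq> V"
    if "Poly_Mapping.keys a \<subseteq> V" "Poly_Mapping.keys b \<subseteq> V" for a b :: "'a \<Rightarrow>\<^sub>0 nat"
    using keys_add[of a b] that by blast
  then show ?thesis
    by (simp add: is_submonoid_def monomials_def)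
qed

section \<open>Saturation and scheme-theoretic generation\<close>

definition monom_degree :: "('x \<Rightarrow>\<^sub>0 nat) \<Rightarrow> nat" where
  "monom_degree m = (\<Sum>x\<in>Poly_Mapping.keys m. Poly_Mapping.lookup m x)"

definition homogeneous_of_degree :: "nat \<Rightarrow> (('x \<Rightarrow>\<^sub>0 nat) \<Rightarrow>\<^sub>0 'k::comm_ring_1) \<Rightarrow> bool" where
  "homogeneous_of_degree n f \<longleftrightarrow> (\<forall>m\<in>Poly_Mapping.keys f. monom_degree m = n)"

definition irrelevant_ideal :: "'x set \<Rightarrow> (('x \<Rightarrow>\<^sub>0 nat) \<Rightarrow>\<^sub>0 'k::comm_ring_1) set" where
  "irrelevant_ideal V = Idl\<^bsub>poly_ring V\<^esub> (poly_var ` V)"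

text \<open>The multiplication of \<^const>\<open>ideals_set\<close> is the product of ideals, so the power below is
  the usual power of an ideal (the whole ring for exponent zero).\<close>

definition saturation ::
    "'x set \<Rightarrow> (('x \<Rightarrow>\<^sub>0 nat) \<Rightarrow>\<^sub>0 'k::comm_ring_1) set \<Rightarrow> (('x \<Rightarrow>\<^sub>0 nat) \<Rightarrow>\<^sub>0 'k) set" where
  "saturation V I =
    {f \<in> carrier (poly_ring V).
      \<exists>k::nat. \<forall>g \<in> irrelevant_ideal V [^]\<^bsub>ideals_set (poly_ring V)\<^esub> k. g * f \<in> I}"

definition scheme_theoretically_generated_in_degree ::
    "nat \<Rightarrow> 'x set \<Rightarrow> (('x \<Rightarrow>\<^sub>0 nat) \<Rightarrow>\<^sub>0 'k::comm_ring_1) set \<Rightarrow> bool" where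
  "scheme_theoretically_generated_in_degree n V I \<longleftrightarrow>
    (\<exists>G J. G \<subseteq> carrier (poly_ring V) \<and> (\<forall>g\<in>G. homogeneous_of_degree n g) \<and>
       J = Idl\<^bsub>poly_ring V\<^esub> G \<and> saturation V I = saturation V J)"

section \<open>Toric ideals\<close>

abbreviation lattice_points :: "'a::euclidean_space set \<Rightarrow> 'a set" where
  "lattice_points P \<equiv> P \<inter> int_lattice"

definition polytope_monoid :: "'a::euclidean_space set \<Rightarrow> ('a \<times> real) set" where
  "polytope_monoid P = is_submonoid hull ((P \<times> {1}) \<inter> int_lattice)"

definition toric_monom :: "('a::euclidean_space \<Rightarrow>\<^sub>0 nat) \<Rightarrow> ('a \<times> real) \<Rightarrow>\<^sub>0 'k::comm_ring_1" where
  "toric_monom m = (\<Prod>x\<in>Poly_Mapping.keys m. Poly_Mapping.single (x, 1) 1 ^ Poly_Mapping.lookup m x)"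

text \<open>Substitution of the monoid element \<open>(x, 1)\<close> for the variable indexed by \<open>x\<close>; the factor
  \<open>single 0 c\<close> is the constant \<open>c\<close> of the monoid algebra. See \<open>toric_map_const\<close>, \<open>toric_map_poly_var\<close>
  and \<open>toric_map_ring_hom\<close>, which characterise this map on polynomials in the lattice points.\<close>

definition toric_map ::
    "(('a::euclidean_space \<Rightarrow>\<^sub>0 nat) \<Rightarrow>\<^sub>0 'k::comm_ring_1) \<Rightarrow> (('a \<times> real) \<Rightarrow>\<^sub>0 'k)" where
  "toric_map f = (\<Sum>m\<in>Poly_Mapping.keys f. Poly_Mapping.single 0 (Poly_Mapping.lookup f m) * toric_monom m)"

definition toric_ideal ::
    "'a::euclidean_space set \<Rightarrow> (('a \<Rightarrow>\<^sub>0 nat) \<Rightarrow>\<^sub>0 'k::comm_ring_1) set" where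
  "toric_ideal P =
    a_kernel (poly_ring (lattice_points P)) (monoid_algebra (polytope_monoid P)) toric_map"

lemma is_submonoid_polytope_monoid: "is_submonoid (polytope_monoid P)"
  unfolding polytope_monoid_def
  by (rule hull_in) (auto simp: is_submonoid_def)

lemma toric_monom_superset:
  assumes "finite A" "Poly_Mapping.keys m \<subseteq> A"
  shows "toric_monom m = (\<Prod>x\<in>A. Poly_Mapping.single (x, 1) 1 ^ Poly_Mapping.lookup m x)"
  unfolding toric_monom_def using assms
  by (intro prod.mono_neutral_left) (auto simp: in_keys_iff)

lemma toric_monom_add: "toric_monom (m + n) = toric_monom m * toric_monom n"
proof -
  have "Poly_Mapping.keys (m + n) \<subseteq> Poly_Mapping.keys m \<union> Poly_Mapping.keys n"
    by (rule keys_add)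
  then show ?thesis
    by (simp add: toric_monom_superset[of "Poly_Mapping.keys m \<union> Poly_Mapping.keys n"] lookup_add power_add
        prod.distrib)
qed

lemma toric_map_add: "toric_map (f + g) = toric_map f + toric_map g"
  unfolding toric_map_def
  by (rule setsum_keys_plus_distrib) (simp_all add: single_add distrib_right)

lemma toric_map_single [simp]:
  "toric_map (Poly_Mapping.single m c) = Poly_Mapping.single 0 c * toric_monom m"
  by (simp add: toric_map_def)

lemma toric_map_sum: "toric_map (\<Sum>i\<in>A. f i) = (\<Sum>i\<in>A. toric_map (f i))"
  by (induction A rule: infinite_finite_induct)
    (simp_all add: toric_map_add, simp_all add: toric_map_def)

lemma poly_mapping_sum_single:
  "(\<Sum>m\<in>Poly_Mapping.keys f. Poly_Mapping.single m (Poly_Mapping.lookup f m)) = f"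
  by (rule poly_mapping_eqI) (simp add: lookup_sum lookup_single when_def in_keys_iff)

lemma toric_map_mult: "toric_map (f * g) = toric_map f * toric_map g"
proof -
  have "toric_map (f * g) = toric_map
      ((\<Sum>m\<in>Poly_Mapping.keys f. Poly_Mapping.single m (Poly_Mapping.lookup f m)) *
       (\<Sum>n\<in>Poly_Mapping.keys g. Poly_Mapping.single n (Poly_Mapping.lookup g n)))"
    by (simp only: poly_mapping_sum_single)
  also have "\<dots> = (\<Sum>m\<in>Poly_Mapping.keys f. \<Sum>n\<in>Poly_Mapping.keys g.
      Poly_Mapping.single 0 (Poly_Mapping.lookup f m * Poly_Mapping.lookup g n) * toric_monom (m + n))"
    by (simp add: sum_product toric_map_sum mult_single)
  also have "\<dots> = toric_map f * toric_map g"
    by (simp add: toric_map_def sum_product toric_monom_add mult_single[of 0 _ 0, simplified, symmetric]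
        mult_ac)
  finally show ?thesis .
qed

lemma toric_map_const: "toric_map (Poly_Mapping.single 0 c) = Poly_Mapping.single 0 c"
  by (simp add: toric_monom_def)

lemma toric_map_poly_var: "toric_map (poly_var x) = Poly_Mapping.single (x, 1) 1"
  by (simp add: poly_var_def toric_monom_def)

lemma toric_map_ring_hom:
  "toric_map \<in> ring_hom (poly_ring (lattice_points P))
     (monoid_algebra (polytope_monoid P) :: (_ \<Rightarrow>\<^sub>0 'k::comm_ring_1) ring)"
proof (rule ring_hom_memI)
  let ?S = "monoid_algebra (polytope_monoid P) :: (_ \<Rightarrow>\<^sub>0 'k) ring"
  interpret S: cring ?S
    by (intro monoid_algebra_cring is_submonoid_polytope_monoid)
  have closed_mult: "Poly_Mapping.keys (f * g) \<subseteq> polytope_monoid P"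
    if "Poly_Mapping.keys f \<subseteq> polytope_monoid P" "Poly_Mapping.keys g \<subseteq> polytope_monoid P" for f g :: "_ \<Rightarrow>\<^sub>0 'k"
    using S.m_closed[of f g] that by simp
  have zero_in: "0 \<in> polytope_monoid P"
    using is_submonoid_polytope_monoid[of P] by (simp add: is_submonoid_def)
  have power: "Poly_Mapping.keys (f ^ n) \<subseteq> polytope_monoid P"
    if "Poly_Mapping.keys f \<subseteq> polytope_monoid P" for f :: "_ \<Rightarrow>\<^sub>0 'k" and n
    by (induction n) (use that closed_mult zero_in in auto)
  have prod: "Poly_Mapping.keys (\<Prod>x\<in>A. F x) \<subseteq> polytope_monoid P"
    if "\<And>x. x \<in> A \<Longrightarrow> Poly_Mapping.keys (F x) \<subseteq> polytope_monoid P" for A and F :: "_ \<Rightarrow> _ \<Rightarrow>\<^sub>0 'k"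
    using that
    by (induction A rule: infinite_finite_induct) (simp_all add: closed_mult zero_in)
  have gen: "(x, 1) \<in> polytope_monoid P" if "x \<in> lattice_points P" for x
    unfolding polytope_monoid_def
    by (rule hull_inc) (use that in \<open>simp add: int_lattice_Pair_iff\<close>)
  fix f :: "_ \<Rightarrow>\<^sub>0 'k" assume f: "f \<in> carrier (poly_ring (lattice_points P))"
  have "Poly_Mapping.keys (Poly_Mapping.single 0 (Poly_Mapping.lookup f m) * toric_monom m) \<subseteq> polytope_monoid P"
    if "m \<in> Poly_Mapping.keys f" for m
  proof (rule closed_mult)
    show "Poly_Mapping.keys (toric_monom m :: _ \<Rightarrow>\<^sub>0 'k) \<subseteq> polytope_monoid P"
      unfolding toric_monom_def
      by (intro prod power) (use f that gen in \<open>auto simp: monomials_def\<close>)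
  qed (simp add: zero_in)
  then show "toric_map f \<in> carrier ?S"
    unfolding toric_map_def monoid_algebra_simps mem_Collect_eq
    by (intro order.trans[OF keys_sum] UN_least)
qed (simp_all add: toric_map_mult toric_map_add toric_map_const[of 1, simplified])

end

theory Submission
  imports Defs
begin

text \<open>
The toric ideal \<open>I\<close> is spanned by the binomials \<open>X\<^sup>a - X\<^sup>b\<close> for monomials \<open>a\<close>, \<open>b\<close> with the same image
in the monoid of the polytope, and variables are nonzerodivisors modulo \<open>I\<close>, so \<open>I\<close> is saturated.  Hence
\<open>I\<close> is scheme-theoretically generated in degree 2 if and only if the ideal \<open>J\<close> generated by its
quadrics agrees with it after inverting any single variable \<open>X\<^sub>x\<close>: for every binomial as above some
\<open>X\<^sub>x\<^sup>k (X\<^sup>a - X\<^sup>b)\<close> must lie in \<open>J\<close>.  A quadric of \<open>I\<close> allows a factor \<open>X\<^sub>y X\<^sub>z\<close> of a monomial to be replaced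
by \<open>X\<^sub>p X\<^sub>q\<close> only if \<open>y + z = p + q\<close>.

The geometric input is \<open>lattice_point_vertex_coordinates\<close>: at a vertex \<open>v\<close> of a smooth polytope, every
lattice point \<open>x\<close> satisfies \<open>x - v = \<Sum> a\<^sub>w (w - v)\<close> with natural numbers \<open>a\<^sub>w\<close> for the neighbors \<open>w\<close> of \<open>v\<close>.
The coefficients are integers because the \<open>w - v\<close> form a lattice basis, and they are nonnegative because a
polytope lies in the cone that its edges span at a vertex, as Krein-Milman applied to the vertex figure
shows.

The conditions are necessary by \<open>scheme_generated_relation_applies\<close>: if \<open>X\<^sup>a - X\<^sup>b\<close> is a nonzero binomial of
\<open>I\<close>, then for some \<open>k\<close> a quadric must apply to \<open>X\<^sub>x\<^sup>k X\<^sup>a\<close>.  For a lattice point \<open>x\<close> that is neither \<open>v\<close> nor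
one of its neighbors, the coordinates at \<open>v\<close> give such a binomial with first term \<open>X\<^sub>x X\<^sub>v\<^sup>s\<^sup>-\<^sup>1\<close>, where \<open>s\<close> is the
sum of the \<open>a\<^sub>w\<close>; since \<open>v\<close> is extreme, after multiplication by a power of \<open>X\<^sub>v\<close> only a quadric
\<open>X\<^sub>x X\<^sub>v - X\<^sub>y X\<^sub>z\<close> can apply, and this is the first condition.  If \<open>x\<close> is not a vertex, a multiple \<open>q x\<close> is a
sum of \<open>q\<close> vertices, and a quadric that applies to a power of \<open>X\<^sub>x\<close> exhibits \<open>x\<close> as a midpoint.

Conversely, by the first condition \<open>X\<^sub>x X\<^sub>v\<close> can be replaced by \<open>X\<^sub>y X\<^sub>z\<close> with both \<open>y\<close> and \<open>z\<close> of smaller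
height over \<open>v\<close>.  So after multiplication by a power of \<open>X\<^sub>v\<close> every monomial becomes congruent modulo \<open>J\<close> to a
monomial in \<open>v\<close> and its neighbors, and these are determined by their image in the monoid: this settles
the variables of vertices (\<open>cong_after_vertex_power\<close>).  If \<open>x\<close> is a midpoint of \<open>y\<close> and \<open>z\<close>, then
\<open>X\<^sub>x\<^sup>2\<close> is congruent to \<open>X\<^sub>y X\<^sub>z\<close>, and one of \<open>y\<close>, \<open>z\<close> has larger norm than \<open>x\<close>; by induction on the norm, some power of
\<open>X\<^sub>x\<close> is congruent to a multiple of \<open>X\<^sub>v\<close> for a vertex \<open>v\<close>, so inverting \<open>X\<^sub>x\<close> inverts \<open>X\<^sub>v\<close> as well.
\<close>

section \<open>The cone of a polytope at a vertex\<close>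

lemma finite_lattice_points:
  fixes S :: "'a::euclidean_space set"
  assumes "bounded S"
  shows "finite (lattice_points S)"
proof -
  obtain M where M: "\<And>x. x \<in> S \<Longrightarrow> norm x \<le> M"
    using assms by (auto simp: bounded_iff)
  let ?f = "\<lambda>x. \<lambda>b\<in>Basis. x \<bullet> b"
  have "inj_on ?f (lattice_points S)"
  proof (rule inj_onI, rule euclidean_eqI)
    fix x y b :: 'a assume "?f x = ?f y" and b: "b \<in> Basis"
    from fun_cong[OF this(1), of b] b show "x \<bullet> b = y \<bullet> b"
      by simp
  qed
  moreover have "?f ` lattice_points S \<subseteq> (Basis \<rightarrow>\<^sub>E {k \<in> \<int>. \<bar>k\<bar> \<le> M})"
    by (auto simp: int_lattice_def restrict_def PiE_iff extensional_def intro: order_trans[OF Basis_le_norm M])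
  moreover have "finite (Basis \<rightarrow>\<^sub>E {k \<in> \<int>. \<bar>k\<bar> \<le> M} :: ('a \<Rightarrow> real) set)"
    by (intro finite_PiE finite_abs_int_segment) simp
  ultimately show ?thesis
    by (meson finite_imageD finite_subset)
qed

lemma int_lattice_add: "x \<in> int_lattice \<Longrightarrow> y \<in> int_lattice \<Longrightarrow> x + y \<in> int_lattice"
  by (simp add: int_lattice_def inner_add_left)

lemma int_lattice_diff: "x \<in> int_lattice \<Longrightarrow> y \<in> int_lattice \<Longrightarrow> x - y \<in> int_lattice"
  by (simp add: int_lattice_def inner_diff_left)

lemma int_lattice_scaleR_int: "x \<in> int_lattice \<Longrightarrow> of_int k *\<^sub>R x \<in> int_lattice"
  by (simp add: int_lattice_def)

lemma int_lattice_sum: "(\<And>i. i \<in> I \<Longrightarrow> f i \<in> int_lattice) \<Longrightarrow> sum f I \<in> int_lattice"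
  by (auto simp: int_lattice_def inner_sum_left intro!: Ints_sum)

lemma int_lattice_norm_less_1:
  fixes x :: "'a::euclidean_space"
  assumes "x \<in> int_lattice" "norm x < 1"
  shows "x = 0"
proof (rule euclidean_eqI)
  fix b :: 'a assume b: "b \<in> Basis"
  have "\<bar>x \<bullet> b\<bar> < 1" "x \<bullet> b \<in> \<int>"
    using Basis_le_norm[OF b, of x] assms b by (auto simp: int_lattice_def)
  then show "x \<bullet> b = 0 \<bullet> b"
    using Ints_nonzero_abs_less1 by auto
qed

lemma lattice_polytope_imp_polytope: "lattice_polytope P \<Longrightarrow> polytope P"
  by (auto simp: lattice_polytope_def polytope_def)

lemma extreme_point_in_int_lattice:
  "lattice_polytope P \<Longrightarrow> v extreme_point_of P \<Longrightarrow> v \<in> int_lattice"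
  by (auto simp: lattice_polytope_def dest: extreme_point_of_convex_hull)

lemma polytope_eq_hull_extreme_points:
  fixes P :: "'a::euclidean_space set"
  shows "polytope P \<Longrightarrow> P = convex hull {v. v extreme_point_of P}"
  by (rule Krein_Milman_Minkowski[OF polytope_imp_compact polytope_imp_convex])

lemma finite_extreme_points:
  assumes "polytope P"
  shows "finite {v. v extreme_point_of P}"
proof -
  obtain S where S: "finite S" "P = convex hull S"
    using assms by (auto simp: polytope_def)
  have "{v. v extreme_point_of P} \<subseteq> S"
    using S(2) extreme_point_of_convex_hull by auto
  then show ?thesis
    using S(1) by (rule finite_subset)
qed

lemma neighbors_subset_lattice_points: "neighbors P v \<subseteq> lattice_points P"
  by (auto simp: neighbors_def dest: edge_of_imp_subset)

lemma finite_neighbors: "polytope P \<Longrightarrow> finite (neighbors P v)"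
  by (meson finite_lattice_points finite_subset neighbors_subset_lattice_points polytope_imp_bounded)

text \<open>On an edge through the vertex \<open>v\<close>, the points other than \<open>v\<close> all lie on the same side of \<open>v\<close>.\<close>

lemma edge_points_between:
  fixes P :: "'a::euclidean_space set"
  assumes E: "E edge_of P" and v: "v extreme_point_of P"
    and mem: "v \<in> E" "a \<in> E" "b \<in> E" and ne: "a \<noteq> v" "b \<noteq> v"
  shows "a \<in> closed_segment v b \<or> b \<in> closed_segment v a"
proof -
  have "collinear E"
    using E by (simp add: edge_of_def collinear_aff_dim)
  then have "collinear {v, a, b}"
    by (rule collinear_subset) (use mem in auto)
  moreover have "v \<notin> open_segment a b"
    using v mem edge_of_imp_subset[OF E] unfolding extreme_point_of_def by blast
  ultimately show ?thesis
    using ne by (auto simp: collinear_between_cases between_mem_segment open_segment_def closed_segment_commute)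
qed

lemma neighbor_on_edge_unique:
  fixes P :: "'a::euclidean_space set"
  assumes E: "E edge_of P" and v: "v extreme_point_of P" "v \<in> E"
    and a: "a \<in> E \<inter> int_lattice" "a \<noteq> v" "open_segment v a \<inter> int_lattice = {}"
    and b: "b \<in> E \<inter> int_lattice" "b \<noteq> v" "open_segment v b \<inter> int_lattice = {}"
  shows "a = b"
  using edge_points_between[OF E v, of a b] a b by (auto simp: open_segment_def)

text \<open>Let \<open>v\<close> lie on the low side of a hyperplane that has all vertices other than \<open>v\<close> on its high
  side.  Then an extreme point of the section of \<open>P\<close> by this hyperplane (the
  vertex figure) lies on an edge through \<open>v\<close>: the smallest face of \<open>P\<close> that contains it meets the
  hyperplane in this point only.\<close>

lemma vertex_figure_extreme_point_on_edge:
  fixes P :: "'a::euclidean_space set"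
  assumes P: "polytope P"
    and low: "l \<bullet> v < c"
    and high: "\<And>u. u extreme_point_of P \<Longrightarrow> u \<noteq> v \<Longrightarrow> c < l \<bullet> u"
    and q: "q extreme_point_of (P \<inter> {x. l \<bullet> x = c})"
  obtains F where "F edge_of P" "q \<in> F" "v \<in> F"
proof -
  define F where "F = \<Inter>{T. T face_of P \<and> q \<in> T}"
  have qP: "q \<in> P" and lq: "l \<bullet> q = c"
    using q by (auto simp: extreme_point_of_def)
  have "P face_of P"
    by (simp add: P polytope_imp_convex face_of_refl)
  then have F: "F face_of P"
    unfolding F_def using qP by (intro face_of_Inter) auto
  have qF: "q \<in> F"
    by (simp add: F_def)
  have pF: "polytope F"
    using face_of_polytope_polytope[OF P F] .
  have hull: "F = convex hull {u. u extreme_point_of F}"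
    using pF by (rule polytope_eq_hull_extreme_points)
  have rel: "q \<in> rel_interior F"
  proof (rule ccontr)
    assume "q \<notin> rel_interior F"
    then have "q \<in> rel_frontier F"
      using qF closure_subset[of F] by (auto simp: rel_frontier_def)
    then obtain T where T: "T face_of F" "T \<noteq> F" "q \<in> T"
      using pF by (auto simp: rel_frontier_of_polyhedron_alt polytope_imp_polyhedron)
    then have "F \<subseteq> T"
      using face_of_trans[OF T(1) F] by (auto simp: F_def)
    then show False
      using T face_of_imp_subset by blast
  qed
  have "v \<in> F"
  proof (rule ccontr)
    assume "v \<notin> F"
    then have "{u. u extreme_point_of F} \<subseteq> {x. c < l \<bullet> x}"
      using high extreme_point_of_face[OF F] by auto
    then have "F \<subseteq> {x. c < l \<bullet> x}"
      by (subst hull) (intro hull_minimal convex_halfspace_gt)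
    then show False
      using qF lq by auto
  qed
  moreover have "aff_dim F \<le> 1"
  proof (rule ccontr)
    assume "\<not> aff_dim F \<le> 1"
    moreover have "\<not> affine hull F \<subseteq> {x. l \<bullet> x = c}"
      using \<open>v \<in> F\<close> hull_subset[of F affine] low by auto
    moreover have "q \<in> affine hull F \<inter> {x. l \<bullet> x = c}"
      using qF lq by (simp add: hull_inc)
    ultimately have "aff_dim (affine hull F \<inter> {x. l \<bullet> x = c}) > 0"
      by (subst aff_dim_affine_Int_hyperplane) auto
    then have "affine hull F \<inter> {x. l \<bullet> x = c} \<noteq> {q}"
      by (metis aff_dim_sing less_irrefl)
    then obtain p where p: "p \<in> affine hull F" "l \<bullet> p = c" "p \<noteq> q"
      using \<open>q \<in> affine hull F \<inter> {x. l \<bullet> x = c}\<close> by blast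
    obtain e where e: "e > 0" "ball q e \<inter> affine hull F \<subseteq> F"
      using rel by (auto simp: mem_rel_interior_ball)
    define s where "s = e / (2 * norm (p - q))"
    have s: "s > 0" "norm (s *\<^sub>R (p - q)) < e"
      using p e by (auto simp: s_def)
    have "q + t *\<^sub>R (p - q) \<in> P \<inter> {x. l \<bullet> x = c}" if t: "\<bar>t\<bar> = s" for t
    proof -
      have "q + t *\<^sub>R (p - q) = (1 - t) *\<^sub>R q + t *\<^sub>R p"
        by (simp add: algebra_simps)
      then have "q + t *\<^sub>R (p - q) \<in> affine hull F"
        using qF p by (simp add: mem_affine[OF affine_affine_hull] hull_inc)
      moreover have "q + t *\<^sub>R (p - q) \<in> ball q e"
        using s t by (auto simp: dist_norm)
      moreover have "l \<bullet> (q + t *\<^sub>R (p - q)) = c"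
        by (simp add: inner_add_right inner_diff_right lq p)
      ultimately show ?thesis
        using e face_of_imp_subset[OF F] by blast
    qed
    from this[of s] this[of "- s"] have "q + s *\<^sub>R (p - q) \<in> P \<inter> {x. l \<bullet> x = c}"
      "q - s *\<^sub>R (p - q) \<in> P \<inter> {x. l \<bullet> x = c}"
      using s by auto
    moreover have "q \<in> open_segment (q - s *\<^sub>R (p - q)) (q + s *\<^sub>R (p - q))"
    proof -
      have "q = midpoint (q - s *\<^sub>R (p - q)) (q + s *\<^sub>R (p - q))"
        by (simp add: midpoint_def scaleR_2[symmetric])
      moreover have "q - s *\<^sub>R (p - q) \<noteq> q + s *\<^sub>R (p - q)"
        using s p by (simp add: algebra_simps flip: scaleR_left_distrib) 
      ultimately show ?thesis
        by (metis midpoint_in_open_segment)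
    qed
    ultimately show False
      using q unfolding extreme_point_of_def by blast
  qed
  moreover have "\<not> aff_dim F \<le> 0"
  proof
    assume "aff_dim F \<le> 0"
    moreover have "aff_dim F \<ge> 0"
      using qF by (metis aff_dim_negative_iff empty_iff not_less)
    ultimately obtain z where "F = {z}"
      by (auto simp: aff_dim_eq_0)
    then show False
      using qF \<open>v \<in> F\<close> low lq by auto
  qed
  ultimately show thesis
    using that[of F] F qF by (simp add: edge_of_def)
qed

text \<open>If \<open>v\<close> and \<open>q\<close> lie on an edge, the other end of the edge is a lattice point, so there is a lattice
  point next to \<open>v\<close> on the edge, and it spans the ray from \<open>v\<close> to \<open>q\<close>.\<close>

lemma edge_spanned_by_neighbor:
  fixes P :: "'a::euclidean_space set"
  assumes P: "lattice_polytope P" and v: "v extreme_point_of P"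
    and F: "F edge_of P" "v \<in> F" "q \<in> F"
  obtains w t where "w \<in> neighbors P v" "t \<ge> 0" "q - v = t *\<^sub>R (w - v)"
proof -
  have ff: "F face_of P"
    using F by (simp add: edge_of_def)
  have pF: "polytope F"
    using P ff face_of_polytope_polytope lattice_polytope_imp_polytope by blast
  have "\<not> {u. u extreme_point_of F} \<subseteq> {v}"
  proof
    assume "{u. u extreme_point_of F} \<subseteq> {v}"
    then have "F \<subseteq> {v}"
      using polytope_eq_hull_extreme_points[OF pF] by (metis convex_singleton hull_minimal)
    then have "aff_dim F \<le> 0"
      by (metis aff_dim_sing aff_dim_subset)
    then show False
      using F by (simp add: edge_of_def)
  qed
  then obtain u where u: "u extreme_point_of F" "u \<noteq> v"
    by auto
  have uF: "u \<in> F" "u \<in> int_lattice"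
    using u extreme_point_of_face[OF ff] extreme_point_in_int_lattice[OF P] by auto
  let ?L = "lattice_points (closed_segment v u) - {v}"
  have "finite ?L" "u \<in> ?L"
    using u uF by (auto intro: finite_lattice_points bounded_closed_segment)
  then obtain w where w: "w \<in> ?L" "\<And>w'. w' \<in> ?L \<Longrightarrow> dist v w \<le> dist v w'"
    using ex_is_arg_min_if_finite[of ?L "dist v"] by (fastforce simp: is_arg_min_linorder)
  have seg: "closed_segment v u \<subseteq> F"
    using uF F face_of_imp_convex[OF ff] by (simp add: closed_segment_subset)
  have "open_segment v w \<inter> int_lattice = {}"
  proof (rule ccontr)
    assume "open_segment v w \<inter> int_lattice \<noteq> {}"
    then obtain z where z: "z \<in> open_segment v w" "z \<in> int_lattice"
      by auto
    then have "z \<in> closed_segment v u"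
      using w(1) by (meson DiffD1 IntD1 closed_segment_subset convex_closed_segment ends_in_segment(1) in_mono open_closed_segment)
    then have "dist v w \<le> dist v z"
      using z by (intro w(2)) (auto simp: open_segment_def)
    then show False
      using dist_in_open_segment[OF z(1)] by (simp add: dist_commute)
  qed
  then have wN: "w \<in> neighbors P v"
    using F w seg by (auto simp: neighbors_def)
  show thesis
  proof (cases "q = v")
    case True
    then show ?thesis
      using that[OF wN, of 0] by simp
  next
    case False
    then have "q \<in> closed_segment v w \<or> w \<in> closed_segment v q"
      using w seg F by (intro edge_points_between[OF F(1) v]) auto
    then show ?thesis
    proof
      assume "q \<in> closed_segment v w"
      then obtain t where "0 \<le> t" "q = (1 - t) *\<^sub>R v + t *\<^sub>R w"
        by (auto simp: in_segment)
      then show ?thesis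
        using that[OF wN, of t] by (simp add: algebra_simps)
    next
      assume "w \<in> closed_segment v q"
      then obtain t where t: "0 \<le> t" "w = (1 - t) *\<^sub>R v + t *\<^sub>R q"
        by (auto simp: in_segment)
      then have "t \<noteq> 0" and "w - v = t *\<^sub>R (q - v)"
        using w(1) by (auto simp: algebra_simps)
      then have "q - v = inverse t *\<^sub>R (w - v)"
        by simp
      then show ?thesis
        using that[OF wN, of "inverse t"] t by simp
    qed
  qed
qed

text \<open>The convex cone generated by \<open>B\<close>, as the set of nonnegative combinations of all elements of \<open>B\<close>;
  this is meant for finite \<open>B\<close>.\<close>

definition nonneg_span :: "'a::real_vector set \<Rightarrow> 'a set" where
  "nonneg_span B = {\<Sum>b\<in>B. t b *\<^sub>R b | t. \<forall>b\<in>B. t b \<ge> (0::real)}"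

lemma nonneg_spanI: "x = (\<Sum>b\<in>B. t b *\<^sub>R b) \<Longrightarrow> (\<And>b. b \<in> B \<Longrightarrow> t b \<ge> 0) \<Longrightarrow> x \<in> nonneg_span B"
  by (auto simp: nonneg_span_def)

lemma nonneg_span_scaleR:
  assumes "x \<in> nonneg_span B" "r \<ge> 0"
  shows "r *\<^sub>R x \<in> nonneg_span B"
proof -
  obtain t where t: "x = (\<Sum>b\<in>B. t b *\<^sub>R b)" "\<forall>b\<in>B. t b \<ge> (0::real)"
    using assms by (auto simp: nonneg_span_def)
  then have "r *\<^sub>R x = (\<Sum>b\<in>B. (r * t b) *\<^sub>R b)"
    by (simp add: scaleR_sum_right)
  then show ?thesis
    using t assms by (auto intro: nonneg_spanI)
qed

lemma nonneg_span_add: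
  assumes "x \<in> nonneg_span B" "y \<in> nonneg_span B"
  shows "x + y \<in> nonneg_span B"
proof -
  obtain s t where "x = (\<Sum>b\<in>B. s b *\<^sub>R b)" "\<forall>b\<in>B. s b \<ge> (0::real)"
    "y = (\<Sum>b\<in>B. t b *\<^sub>R b)" "\<forall>b\<in>B. t b \<ge> (0::real)"
    using assms by (auto simp: nonneg_span_def)
  then show ?thesis
    by (intro nonneg_spanI[where t = "\<lambda>b. s b + t b"]) (simp_all add: scaleR_left_distrib sum.distrib)
qed

lemma nonneg_span_base:
  assumes "finite B" "b \<in> B"
  shows "b \<in> nonneg_span B"
proof -
  have "b = (\<Sum>a\<in>B. (if a = b then 1 else 0) *\<^sub>R a)"
    using assms by (simp add: if_distrib[of "\<lambda>t. t *\<^sub>R _"] cong: if_cong)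
  then show ?thesis
    by (rule nonneg_spanI) simp
qed

lemma convex_translated_nonneg_span: "convex {x. x - v \<in> nonneg_span B}"
proof (rule convexI)
  fix x y and r s :: real
  assume *: "x \<in> {x. x - v \<in> nonneg_span B}" "y \<in> {x. x - v \<in> nonneg_span B}"
    "0 \<le> r" "0 \<le> s" "r + s = 1"
  then have "r *\<^sub>R x + s *\<^sub>R y - v = r *\<^sub>R (x - v) + s *\<^sub>R (y - v)"
    by (simp add: algebra_simps flip: scaleR_left_distrib)
  then show "r *\<^sub>R x + s *\<^sub>R y \<in> {x. x - v \<in> nonneg_span B}"
    using * by (simp add: nonneg_span_add nonneg_span_scaleR)
qed

text \<open>A polytope lies in the cone that its edges span at a vertex.  The extreme points of the vertex figure
  lie on edges, so the whole vertex figure lies in the cone; every segment from \<open>v\<close> to another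
  vertex crosses it.\<close>

lemma polytope_subset_vertex_cone:
  fixes P :: "'a::euclidean_space set"
  assumes P: "lattice_polytope P" and v: "v extreme_point_of P" and "y \<in> P"
  shows "y - v \<in> nonneg_span ((\<lambda>w. w - v) ` neighbors P v)"
proof -
  let ?V = "{u. u extreme_point_of P}"
  let ?B = "(\<lambda>w. w - v) ` neighbors P v"
  let ?C = "{x. x - v \<in> nonneg_span ?B}"
  have pP: "polytope P"
    using P by (rule lattice_polytope_imp_polytope)
  have fin: "finite ?B"
    using pP by (simp add: finite_neighbors)
  have vC: "v \<in> ?C"
    by (auto simp: nonneg_span_def intro!: exI[of _ "\<lambda>_. 0"])
  have "convex hull (?V - {v}) \<subseteq> P - {v}"
    using v extreme_point_of_stillconvex[of P v] polytope_imp_convex[OF pP]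
    by (intro hull_minimal) (auto simp: extreme_point_of_def)
  then have "v \<notin> convex hull (?V - {v})"
    by auto
  moreover have "closed (convex hull (?V - {v}))"
    using finite_extreme_points[OF pP] by (simp add: compact_imp_closed finite_imp_compact_convex_hull)
  ultimately obtain l c where lc: "l \<bullet> v < c" "\<And>x. x \<in> convex hull (?V - {v}) \<Longrightarrow> c < l \<bullet> x"
    using separating_hyperplane_closed_point[OF convex_convex_hull, of "?V - {v}" v] by auto
  have high: "c < l \<bullet> u" if "u extreme_point_of P" "u \<noteq> v" for u
    using that by (intro lc hull_inc) auto
  let ?Q = "P \<inter> {x. l \<bullet> x = c}"
  have "q \<in> ?C" if q: "q extreme_point_of ?Q" for q
  proof -
    obtain F where F: "F edge_of P" "q \<in> F" "v \<in> F"
      using vertex_figure_extreme_point_on_edge[OF pP lc(1) high q] by blast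
    obtain w t where "w \<in> neighbors P v" "t \<ge> 0" "q - v = t *\<^sub>R (w - v)"
      using edge_spanned_by_neighbor[OF P v F(1,3,2)] .
    then show ?thesis
      using fin by (auto intro: nonneg_span_scaleR nonneg_span_base)
  qed
  then have "convex hull {q. q extreme_point_of ?Q} \<subseteq> ?C"
    by (intro hull_minimal convex_translated_nonneg_span) auto
  moreover have "?Q = convex hull {q. q extreme_point_of ?Q}"
    using pP by (intro Krein_Milman_Minkowski compact_Int_closed convex_Int polytope_imp_compact
        polytope_imp_convex closed_hyperplane convex_hyperplane)
  ultimately have QC: "?Q \<subseteq> ?C"
    by simp
  have "u \<in> ?C" if u: "u extreme_point_of P" for u
  proof (cases "u = v")
    case False
    \<comment> \<open>the point where the segment from \<open>v\<close> to \<open>u\<close> crosses the hyperplane\<close>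
    define r where "r = (c - l \<bullet> v) / (l \<bullet> u - l \<bullet> v)"
    have r: "0 < r" "r \<le> 1" "r * (l \<bullet> u - l \<bullet> v) = c - l \<bullet> v"
      using lc(1) high[OF u False] by (auto simp: r_def field_simps)
    let ?q = "(1 - r) *\<^sub>R v + r *\<^sub>R u"
    have "?q \<in> P"
      using u v r polytope_imp_convex[OF pP] by (intro convexD) (auto simp: extreme_point_of_def)
    moreover have "l \<bullet> ?q = c"
      using r by (simp add: inner_add_right algebra_simps)
    ultimately have "?q - v \<in> nonneg_span ?B"
      using QC by auto
    then have "inverse r *\<^sub>R (?q - v) \<in> nonneg_span ?B"
      using r by (intro nonneg_span_scaleR) auto
    moreover have "?q - v = r *\<^sub>R (u - v)"
      by (simp add: algebra_simps)
    ultimately show ?thesis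
      using r by simp
  qed (use vC in simp)
  then have "P \<subseteq> ?C"
    by (subst polytope_eq_hull_extreme_points[OF pP])
       (intro hull_minimal convex_translated_nonneg_span, auto)
  then show ?thesis
    using \<open>y \<in> P\<close> by auto
qed

section \<open>Coordinates at a vertex of a smooth polytope\<close>

text \<open>Independence over the integers is turned into independence over the reals by counting: at most one
  neighbor lies on each of the \<open>d\<close> edges at \<open>v\<close>, and the edge vectors span the lattice, hence the
  whole space.\<close>

lemma neighbor_vectors_basis:
  fixes P :: "'a::euclidean_space set"
  assumes P: "smooth_lattice_polytope P" and v: "v extreme_point_of P"
  shows "independent ((\<lambda>w. w - v) ` neighbors P v)"
    and "\<And>x. x \<in> int_lattice \<Longrightarrow> \<exists>a. x = (\<Sum>w\<in>neighbors P v. real_of_int (a w) *\<^sub>R (w - v))"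
proof -
  let ?N = "neighbors P v" and ?B = "(\<lambda>w. w - v) ` neighbors P v"
  let ?E = "{E. E edge_of P \<and> v \<in> E}"
  have P': "polytope P" "card ?E = DIM('a)" "int_module.span ?B = int_lattice"
    using P v lattice_polytope_imp_polytope
    by (auto simp: smooth_lattice_polytope_def lattice_basis_def)
  have fin: "finite ?N"
    using P' by (simp add: finite_neighbors)
  have inj: "inj_on (\<lambda>w. w - v) ?N"
    by (auto simp: inj_on_def)
  show expand: "\<exists>a. x = (\<Sum>w\<in>?N. real_of_int (a w) *\<^sub>R (w - v))" if "x \<in> int_lattice" for x
  proof -
    have "x \<in> int_module.span ?B"
      using P' that by simp
    then obtain a where "x = (\<Sum>b\<in>?B. real_of_int (a b) *\<^sub>R b)"
      using fin by (auto simp: int_module.span_finite)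
    then show ?thesis
      by (subst (asm) sum.reindex[OF inj]) auto
  qed
  have "card ?B \<le> card ?E"
  proof -
    define e where "e w = (SOME E. E edge_of P \<and> v \<in> E \<and> w \<in> E)" for w
    have e: "e w edge_of P \<and> v \<in> e w \<and> w \<in> e w" "w \<in> int_lattice" "w \<noteq> v"
      "open_segment v w \<inter> int_lattice = {}" if "w \<in> ?N" for w
      using that unfolding e_def by (auto simp: neighbors_def intro: someI2)
    have "inj_on e ?N"
    proof (rule inj_onI)
      fix a b assume "a \<in> ?N" "b \<in> ?N" "e a = e b"
      then show "a = b"
        using e[of a] e[of b] neighbor_on_edge_unique[of "e a" P v a b] v by auto
    qed
    moreover have "finite ?E"
      using finite_polytope_faces[OF P'(1)] by (rule finite_subset[rotated]) (auto simp: edge_of_def)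
    ultimately have "card ?N \<le> card ?E"
      using e by (intro card_inj_on_le[of e]) auto
    then show ?thesis
      using card_image[OF inj] by simp
  qed
  moreover have "span ?B = UNIV"
  proof -
    have "b \<in> span ?B" if b: "b \<in> Basis" for b
    proof -
      have "b \<in> int_lattice"
        using b by (auto simp: int_lattice_def inner_Basis)
      then obtain a where "b = (\<Sum>w\<in>?N. real_of_int (a w) *\<^sub>R (w - v))"
        using expand by blast
      also have "\<dots> \<in> span ?B"
        by (intro span_sum span_scale span_base) auto
      finally show ?thesis .
    qed
    then have "span Basis \<subseteq> span ?B"
      by (intro span_minimal) auto
    then show ?thesis
      by auto
  qed
  moreover have "finite ?B"
    using fin by simp
  ultimately show "independent ?B"
    using P'(2) by (metis card_le_dim_spanning dim_UNIV subset_UNIV order_refl)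
qed

lemma neighbor_coefficients_unique:
  fixes P :: "'a::euclidean_space set" and a b :: "'a \<Rightarrow> real"
  assumes P: "smooth_lattice_polytope P" and v: "v extreme_point_of P"
    and eq: "(\<Sum>w\<in>neighbors P v. a w *\<^sub>R (w - v)) = (\<Sum>w\<in>neighbors P v. b w *\<^sub>R (w - v))"
    and w: "w \<in> neighbors P v"
  shows "a w = b w"
proof -
  let ?N = "neighbors P v" and ?B = "(\<lambda>w. w - v) ` neighbors P v"
  have fin: "finite ?N"
    using P by (simp add: finite_neighbors smooth_lattice_polytope_def lattice_polytope_imp_polytope)
  have inj: "inj_on (\<lambda>w. w - v) ?N"
    by (auto simp: inj_on_def)
  have "(\<Sum>w\<in>?N. (a w - b w) *\<^sub>R (w - v)) = 0"
    using eq by (simp add: scaleR_left_diff_distrib sum_subtractf)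
  then have "(\<Sum>x\<in>?B. (a (x + v) - b (x + v)) *\<^sub>R x) = 0"
    by (subst sum.reindex[OF inj]) simp
  then have "a ((w - v) + v) - b ((w - v) + v) = 0"
    using neighbor_vectors_basis(1)[OF P v] fin w independentD[of ?B ?B "\<lambda>x. a (x + v) - b (x + v)" "w - v"]
    by auto
  then show ?thesis
    by simp
qed

text \<open>In the coordinates given by the neighbors of a vertex, the lattice points of a smooth polytope
  have nonnegative integer coordinates: they are integers because the neighbors give a lattice basis
  and nonnegative because the polytope lies in the cone at the vertex.\<close>

lemma lattice_point_vertex_coordinates:
  fixes P :: "'a::euclidean_space set"
  assumes P: "smooth_lattice_polytope P" and v: "v extreme_point_of P" and y: "y \<in> lattice_points P"
  obtains a :: "'a \<Rightarrow> nat" where "y - v = (\<Sum>w\<in>neighbors P v. real (a w) *\<^sub>R (w - v))"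
proof -
  let ?N = "neighbors P v" and ?B = "(\<lambda>w. w - v) ` neighbors P v"
  have inj: "inj_on (\<lambda>w. w - v) ?N"
    by (auto simp: inj_on_def)
  have lP: "lattice_polytope P"
    using P by (simp add: smooth_lattice_polytope_def)
  have "y - v \<in> int_lattice"
    using y extreme_point_in_int_lattice[OF lP v] by (auto intro: int_lattice_diff)
  then obtain a where a: "y - v = (\<Sum>w\<in>?N. real_of_int (a w) *\<^sub>R (w - v))"
    using neighbor_vectors_basis(2)[OF P v] by blast
  have "y - v \<in> nonneg_span ?B"
    using polytope_subset_vertex_cone[OF lP v] y by auto
  then obtain t where t: "y - v = (\<Sum>b\<in>?B. t b *\<^sub>R b)" "\<And>b. b \<in> ?B \<Longrightarrow> t b \<ge> (0::real)"
    by (auto simp: nonneg_span_def)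
  have "y - v = (\<Sum>w\<in>?N. t (w - v) *\<^sub>R (w - v))"
    using t(1) by (subst (asm) sum.reindex[OF inj]) auto
  with a have "real_of_int (a w) = t (w - v)" if "w \<in> ?N" for w
    by (intro neighbor_coefficients_unique[OF P v _ that]) simp
  then have "0 \<le> a w" if "w \<in> ?N" for w
    using t(2) that by (metis image_eqI of_int_0_le_iff)
  then have "y - v = (\<Sum>w\<in>?N. real (nat (a w)) *\<^sub>R (w - v))"
    unfolding a by (intro sum.cong) auto
  then show thesis
    by (rule that)
qed

text \<open>The height over a vertex: a linear functional that is \<open>1\<close> on all vectors from the vertex to its
  neighbors.\<close>

lemma vertex_height_exists:
  fixes P :: "'a::euclidean_space set"
  assumes P: "smooth_lattice_polytope P" and v: "v extreme_point_of P"
  obtains h :: "'a \<Rightarrow> real" where "linear h" "\<And>w. w \<in> neighbors P v \<Longrightarrow> h (w - v) = 1"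
    "\<And>y. y \<in> lattice_points P \<Longrightarrow> h (y - v) \<in> \<nat>"
    "\<And>y. y \<in> lattice_points P \<Longrightarrow> y \<noteq> v \<Longrightarrow> h (y - v) \<ge> 1"
proof -
  let ?N = "neighbors P v"
  obtain h :: "'a \<Rightarrow> real" where h: "linear h" "\<forall>x\<in>(\<lambda>w. w - v) ` ?N. h x = 1"
    using linear_independent_extend[OF neighbor_vectors_basis(1)[OF P v], of "\<lambda>_. 1"] by auto
  have fin: "finite ?N"
    using P by (simp add: finite_neighbors smooth_lattice_polytope_def lattice_polytope_imp_polytope)
  have *: "\<exists>n. h (y - v) = real n \<and> (n = 0 \<longrightarrow> y = v)" if y: "y \<in> lattice_points P" for y
  proof -
    obtain a :: "'a \<Rightarrow> nat" where a: "y - v = (\<Sum>w\<in>?N. real (a w) *\<^sub>R (w - v))"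
      using lattice_point_vertex_coordinates[OF P v y] .
    have "h (y - v) = (\<Sum>w\<in>?N. real (a w) * h (w - v))"
      by (simp add: a linear_sum[OF h(1)] linear_scale[OF h(1)])
    also have "\<dots> = real (\<Sum>w\<in>?N. a w)"
      using h(2) by simp
    finally have "h (y - v) = real (\<Sum>w\<in>?N. a w)" .
    moreover have "y = v" if "(\<Sum>w\<in>?N. a w) = 0"
      using that a fin by simp
    ultimately show ?thesis
      by (intro exI[of _ "\<Sum>w\<in>?N. a w"]) simp
  qed
  show thesis
  proof (rule that[of h])
    show "h (y - v) \<in> \<nat>" if "y \<in> lattice_points P" for y
      using *[OF that] by auto
    show "h (y - v) \<ge> 1" if y: "y \<in> lattice_points P" "y \<noteq> v" for y
    proof -
      obtain n where "h (y - v) = real n" "n \<noteq> 0"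
        using *[OF y(1)] y(2) by blast
      then show ?thesis
        by simp
    qed
  qed (use h in auto)
qed

text \<open>A lattice point in a lattice polytope has some multiple that is a sum of vertices.  By
  simultaneous Dirichlet approximation, real barycentric coordinates have a common approximate
  denominator \<open>q\<close>; for a sufficiently good approximation the rounded coordinates are exact, because
  the error is a lattice vector of norm less than one.\<close>

lemma multiple_is_sum_of_vertices:
  fixes P :: "'a::euclidean_space set"
  assumes P: "lattice_polytope P" and x: "x \<in> lattice_points P"
  obtains q :: nat and p :: "'a \<Rightarrow> nat" where "q > 0"
    "(\<Sum>u | u extreme_point_of P. p u) = q"
    "(\<Sum>u | u extreme_point_of P. real (p u) *\<^sub>R u) = real q *\<^sub>R x"
proof -
  let ?V = "{u. u extreme_point_of P}"
  have pP: "polytope P"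
    using P by (rule lattice_polytope_imp_polytope)
  have fin: "finite ?V"
    using pP by (rule finite_extreme_points)
  have "x \<in> convex hull ?V"
    using x polytope_eq_hull_extreme_points[OF pP] by auto
  then obtain t where t: "\<And>u. u \<in> ?V \<Longrightarrow> 0 \<le> t u" "sum t ?V = 1" "(\<Sum>u\<in>?V. t u *\<^sub>R u) = x"
    using fin by (auto simp: convex_hull_finite)
  obtain f where f: "bij_betw f ?V {..<card ?V}"
    using ex_bij_betw_finite_nat[OF fin] by (metis lessThan_atLeast0)
  define M where "M = (\<Sum>u\<in>?V. norm u + 1)"
  obtain N :: nat where "max 0 M < N"
    using reals_Archimedean2 by blast
  then have N: "N > 0" "M < N"
    by auto
  obtain q p where q: "0 < q" "q \<le> int (N ^ card ?V)"
      and p: "\<And>i. i < card ?V \<Longrightarrow> \<bar>of_int q * t (inv_into ?V f i) - of_int (p i)\<bar> < 1 / N"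
    using Dirichlet_approx_simult[OF N(1), of "card ?V" "\<lambda>i. t (inv_into ?V f i)"] by blast
  define r where "r u = of_int q * t u - of_int (p (f u))" for u
  have r: "\<bar>r u\<bar> < 1 / N" if "u \<in> ?V" for u
  proof -
    have "f u < card ?V"
      using bij_betwE[OF f] that by auto
    moreover have "inv_into ?V f (f u) = u"
      using f that by (intro inv_into_f_f) (auto simp: bij_betw_def)
    ultimately show ?thesis
      using p[of "f u"] by (simp add: r_def)
  qed
  have nonneg: "0 \<le> p (f u)" if "u \<in> ?V" for u
  proof (rule ccontr)
    assume "\<not> 0 \<le> p (f u)"
    then have "real_of_int (p (f u)) \<le> -1"
      by linarith
    moreover have "0 \<le> of_int q * t u"
      using t(1)[OF that] q by simp
    ultimately have "1 \<le> r u"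
      by (simp add: r_def)
    moreover have "1 / real N \<le> 1"
      using N by simp
    ultimately show False
      using r[OF that] by linarith
  qed
  have small: "(\<Sum>u\<in>?V. \<bar>r u\<bar> * (norm u + 1)) < 1"
  proof -
    have "(\<Sum>u\<in>?V. \<bar>r u\<bar> * (norm u + 1)) \<le> (\<Sum>u\<in>?V. 1 / N * (norm u + 1))"
      using r by (intro sum_mono mult_right_mono) (auto intro: less_imp_le)
    also have "\<dots> = M / N"
      by (simp add: M_def sum_divide_distrib)
    also have "\<dots> < 1"
      using N by simp
    finally show ?thesis .
  qed
  have "of_int q - (\<Sum>u\<in>?V. of_int (p (f u))) = (\<Sum>u\<in>?V. r u)"
    using t(2) by (simp add: r_def sum_subtractf flip: sum_distrib_left)
  also have "\<bar>\<dots>\<bar> \<le> (\<Sum>u\<in>?V. \<bar>r u\<bar> * (norm u + 1))"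
    by (intro order_trans[OF sum_abs] sum_mono) (simp add: mult_le_cancel_left1)
  also note small
  finally have sum1: "q = (\<Sum>u\<in>?V. p (f u))"
    by (simp flip: of_int_sum of_int_diff of_int_abs)
  have "of_int q *\<^sub>R x - (\<Sum>u\<in>?V. of_int (p (f u)) *\<^sub>R u) = (\<Sum>u\<in>?V. r u *\<^sub>R u)"
    by (simp add: r_def scaleR_left_diff_distrib sum_subtractf flip: t(3))
       (simp add: scaleR_sum_right)
  also have "norm \<dots> \<le> (\<Sum>u\<in>?V. \<bar>r u\<bar> * (norm u + 1))"
    by (intro order_trans[OF norm_sum] sum_mono) (simp add: mult_left_mono)
  also note small
  finally have "norm (of_int q *\<^sub>R x - (\<Sum>u\<in>?V. of_int (p (f u)) *\<^sub>R u)) < 1" .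
  moreover have "of_int q *\<^sub>R x - (\<Sum>u\<in>?V. of_int (p (f u)) *\<^sub>R u) \<in> int_lattice"
    using x by (intro int_lattice_diff int_lattice_sum int_lattice_scaleR_int)
      (auto intro: extreme_point_in_int_lattice[OF P])
  ultimately have sum2: "of_int q *\<^sub>R x = (\<Sum>u\<in>?V. of_int (p (f u)) *\<^sub>R u)"
    using int_lattice_norm_less_1 by fastforce
  show thesis
  proof (rule that[of "nat q" "\<lambda>u. nat (p (f u))"])
    have "int (\<Sum>u\<in>?V. nat (p (f u))) = (\<Sum>u\<in>?V. p (f u))"
      unfolding of_nat_sum using nonneg by (intro sum.cong) auto
    then show "(\<Sum>u\<in>?V. nat (p (f u))) = nat q"
      using sum1 by linarith
    show "(\<Sum>u\<in>?V. real (nat (p (f u))) *\<^sub>R u) = real (nat q) *\<^sub>R x"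
      using sum2 nonneg q by simp
  qed (use q in simp)
qed

section \<open>Monomials and ideals of polynomial rings\<close>

lemma keys_add_nat: "Poly_Mapping.keys (m + n) = Poly_Mapping.keys m \<union> Poly_Mapping.keys n"
  for m n :: "'x \<Rightarrow>\<^sub>0 nat"
  by (auto simp: in_keys_iff lookup_add)

lemma monomials_add_iff: "m + n \<in> monomials V \<longleftrightarrow> m \<in> monomials V \<and> n \<in> monomials V"
  by (simp add: monomials_def keys_add_nat)

lemma zero_in_monomials [simp]: "0 \<in> monomials V"
  by (simp add: monomials_def)

lemma single_in_monomials: "x \<in> V \<Longrightarrow> Poly_Mapping.single x k \<in> monomials V"
  by (simp add: monomials_def)

lemma monom_degree_superset:
  "finite A \<Longrightarrow> Poly_Mapping.keys m \<subseteq> A \<Longrightarrow> monom_degree m = (\<Sum>x\<in>A. Poly_Mapping.lookup m x)"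
  unfolding monom_degree_def by (intro sum.mono_neutral_left) (auto simp: in_keys_iff)

lemma monom_degree_add: "monom_degree (m + n) = monom_degree m + monom_degree n"
  by (simp add: monom_degree_superset[of "Poly_Mapping.keys m \<union> Poly_Mapping.keys n"] keys_add_nat
      lookup_add sum.distrib)

lemma monom_degree_single [simp]: "monom_degree (Poly_Mapping.single x k) = k"
  by (simp add: monom_degree_def)

lemma monom_degree_zero [simp]: "monom_degree 0 = 0"
  by (simp add: monom_degree_def)

lemma monomial_split:
  fixes m :: "'x \<Rightarrow>\<^sub>0 nat"
  assumes "k \<le> Poly_Mapping.lookup m x"
  obtains n where "m = Poly_Mapping.single x k + n"
proof
  show "m = Poly_Mapping.single x k + (m - Poly_Mapping.single x k)"
    using assms by (intro poly_mapping_eqI) (auto simp: lookup_add lookup_minus lookup_single when_def)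
qed

lemma monomials_induct [consumes 1, case_names zero add]:
  assumes "m \<in> monomials V" and "Q 0"
    and step: "\<And>x m. x \<in> V \<Longrightarrow> m \<in> monomials V \<Longrightarrow> Q m \<Longrightarrow> Q (Poly_Mapping.single x 1 + m)"
  shows "Q m"
  using assms(1)
proof (induction "monom_degree m" arbitrary: m rule: less_induct)
  case less
  show ?case
  proof (cases "m = 0")
    case False
    then obtain x where x: "x \<in> Poly_Mapping.keys m"
      by fastforce
    then obtain n where n: "m = Poly_Mapping.single x 1 + n"
      using monomial_split[of 1 m x] by (auto simp: in_keys_iff)
    then have "n \<in> monomials V" "x \<in> V"
      using less.prems x by (auto simp: monomials_def keys_add_nat)
    then show ?thesis
      using less.hyps[of n] step by (simp add: n monom_degree_add)
  qed (simp add: \<open>Q 0\<close>)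
qed

lemma poly_ring_cring: "cring (poly_ring V :: (('x \<Rightarrow>\<^sub>0 nat) \<Rightarrow>\<^sub>0 'k::comm_ring_1) ring)"
  by (intro monoid_algebra_cring is_submonoid_monomials)

lemma poly_ring_ring: "ring (poly_ring V :: (('x \<Rightarrow>\<^sub>0 nat) \<Rightarrow>\<^sub>0 'k::comm_ring_1) ring)"
  using poly_ring_cring cring.axioms(1) by blast

lemma poly_ring_a_inv:
  fixes f :: "('x \<Rightarrow>\<^sub>0 nat) \<Rightarrow>\<^sub>0 'k::comm_ring_1"
  assumes "Poly_Mapping.keys f \<subseteq> monomials V"
  shows "\<ominus>\<^bsub>poly_ring V\<^esub> f = - f"
proof -
  interpret ring "poly_ring V :: (('x \<Rightarrow>\<^sub>0 nat) \<Rightarrow>\<^sub>0 'k) ring"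
    by (rule poly_ring_ring)
  show ?thesis
    using assms by (intro minus_equality) auto
qed

context
  fixes V :: "'x set" and I :: "(('x \<Rightarrow>\<^sub>0 nat) \<Rightarrow>\<^sub>0 'k::comm_ring_1) set"
  assumes I: "ideal I (poly_ring V)"
begin

lemma poly_ideal_keys: "f \<in> I \<Longrightarrow> Poly_Mapping.keys f \<subseteq> monomials V"
  using ideal.Icarr[OF I] by simp

lemma poly_ideal_zero: "0 \<in> I"
  using additive_subgroup.zero_closed[OF ideal.axioms(1)[OF I]] by simp

lemma poly_ideal_add: "f \<in> I \<Longrightarrow> g \<in> I \<Longrightarrow> f + g \<in> I"
  using additive_subgroup.a_closed[OF ideal.axioms(1)[OF I]] by simp

lemma poly_ideal_uminus: "f \<in> I \<Longrightarrow> - f \<in> I"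
  using additive_subgroup.a_inv_closed[OF ideal.axioms(1)[OF I], of f] poly_ring_a_inv poly_ideal_keys
    ideal.axioms(2)[OF I] by (metis poly_ring_ring)

lemma poly_ideal_mult: "f \<in> I \<Longrightarrow> Poly_Mapping.keys g \<subseteq> monomials V \<Longrightarrow> g * f \<in> I"
  using ideal.I_l_closed[OF I] by simp

lemma poly_ideal_monomial_mult:
  "f \<in> I \<Longrightarrow> m \<in> monomials V \<Longrightarrow> Poly_Mapping.single m c * f \<in> I"
  by (rule poly_ideal_mult) auto

lemma poly_ideal_sum: "(\<And>i. i \<in> A \<Longrightarrow> f i \<in> I) \<Longrightarrow> sum f A \<in> I"
  by (induction A rule: infinite_finite_induct) (auto simp: poly_ideal_zero poly_ideal_add)

end

lemma poly_idealI:
  fixes I :: "(('x \<Rightarrow>\<^sub>0 nat) \<Rightarrow>\<^sub>0 'k::comm_ring_1) set"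
  assumes keys: "\<And>f. f \<in> I \<Longrightarrow> Poly_Mapping.keys f \<subseteq> monomials V"
    and zero: "0 \<in> I" and add: "\<And>f g. f \<in> I \<Longrightarrow> g \<in> I \<Longrightarrow> f + g \<in> I"
    and mult: "\<And>f g. f \<in> I \<Longrightarrow> Poly_Mapping.keys g \<subseteq> monomials V \<Longrightarrow> g * f \<in> I"
  shows "ideal I (poly_ring V)"
proof (rule idealI)
  interpret ring "poly_ring V :: (('x \<Rightarrow>\<^sub>0 nat) \<Rightarrow>\<^sub>0 'k) ring"
    by (rule poly_ring_ring)
  show "ring (poly_ring V :: (('x \<Rightarrow>\<^sub>0 nat) \<Rightarrow>\<^sub>0 'k) ring)"
    by (rule poly_ring_ring)
  have uminus: "- f \<in> I" if "f \<in> I" for f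
    using mult[OF that, of "-1"] by simp
  show "subgroup I (add_monoid (poly_ring V))"
    using keys zero add uminus poly_ring_a_inv[OF keys]
    by (intro add.subgroupI) (auto simp: a_inv_def[symmetric])
  show "x \<otimes>\<^bsub>poly_ring V\<^esub> a \<in> I" if "a \<in> I" "x \<in> carrier (poly_ring V)" for a x
    using that mult by simp
  then show "a \<otimes>\<^bsub>poly_ring V\<^esub> x \<in> I" if "a \<in> I" "x \<in> carrier (poly_ring V)" for a x
    using that mult by (simp add: mult.commute)
qed

lemma genideal_poly:
  fixes G :: "(('x \<Rightarrow>\<^sub>0 nat) \<Rightarrow>\<^sub>0 'k::comm_ring_1) set"
  assumes "G \<subseteq> carrier (poly_ring V)"
  shows "ideal (Idl\<^bsub>poly_ring V\<^esub> G) (poly_ring V)" "G \<subseteq> Idl\<^bsub>poly_ring V\<^esub> G"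
    "\<And>I. ideal I (poly_ring V) \<Longrightarrow> G \<subseteq> I \<Longrightarrow> Idl\<^bsub>poly_ring V\<^esub> G \<subseteq> I"
proof -
  interpret ring "poly_ring V :: (('x \<Rightarrow>\<^sub>0 nat) \<Rightarrow>\<^sub>0 'k) ring"
    by (rule poly_ring_ring)
  show "ideal (Idl\<^bsub>poly_ring V\<^esub> G) (poly_ring V)" "G \<subseteq> Idl\<^bsub>poly_ring V\<^esub> G"
    using genideal_ideal[of G] genideal_self[of G] assms by auto
  show "\<And>I. ideal I (poly_ring V) \<Longrightarrow> G \<subseteq> I \<Longrightarrow> Idl\<^bsub>poly_ring V\<^esub> G \<subseteq> I"
    by (rule genideal_minimal)
qed

text \<open>A set of monomials that is closed under multiplication by monomials spans an ideal.\<close>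

lemma monomial_ideal:
  assumes "U \<subseteq> monomials V" "\<And>m n. m \<in> monomials V \<Longrightarrow> n \<in> U \<Longrightarrow> m + n \<in> U"
  shows "ideal {f :: ('x \<Rightarrow>\<^sub>0 nat) \<Rightarrow>\<^sub>0 'k::comm_ring_1. Poly_Mapping.keys f \<subseteq> U} (poly_ring V)"
proof (rule poly_idealI)
  fix f g :: "('x \<Rightarrow>\<^sub>0 nat) \<Rightarrow>\<^sub>0 'k"
  assume f: "f \<in> {f. Poly_Mapping.keys f \<subseteq> U}"
  then show "Poly_Mapping.keys f \<subseteq> monomials V"
    using assms(1) by auto
  show "f + g \<in> {f. Poly_Mapping.keys f \<subseteq> U}" if "g \<in> {f. Poly_Mapping.keys f \<subseteq> U}"
    using f that keys_add[of f g] by auto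
  show "g * f \<in> {f. Poly_Mapping.keys f \<subseteq> U}" if "Poly_Mapping.keys g \<subseteq> monomials V"
    using f that keys_mult[of g f] assms(2) by blast
qed simp

section \<open>Saturation by powers of variables\<close>

lemma ideal_power_Suc:
  "I [^]\<^bsub>ideals_set R\<^esub> Suc k = ideal_prod R (I [^]\<^bsub>ideals_set R\<^esub> k) I"
  by (simp add: ideals_set_def)

lemma var_power_in_irrelevant_power:
  assumes "x \<in> V"
  shows "(Poly_Mapping.single (Poly_Mapping.single x k) 1 :: ('x \<Rightarrow>\<^sub>0 nat) \<Rightarrow>\<^sub>0 'k::comm_ring_1)
    \<in> irrelevant_ideal V [^]\<^bsub>ideals_set (poly_ring V)\<^esub> k"
proof (induction k)
  case 0
  then show ?case
    by (simp add: ideals_set_def)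
next
  case (Suc k)
  have "(poly_var x :: ('x \<Rightarrow>\<^sub>0 nat) \<Rightarrow>\<^sub>0 'k) \<in> irrelevant_ideal V"
    unfolding irrelevant_ideal_def
    using assms by (intro subsetD[OF genideal_poly(2)]) (auto simp: poly_var_def single_in_monomials)
  then have "Poly_Mapping.single (Poly_Mapping.single x k) 1 * (poly_var x :: ('x \<Rightarrow>\<^sub>0 nat) \<Rightarrow>\<^sub>0 'k)
      \<in> irrelevant_ideal V [^]\<^bsub>ideals_set (poly_ring V)\<^esub> Suc k"
    unfolding ideal_power_Suc using ideal_prod.prod[OF Suc, of "poly_var x" _ "poly_ring V"] by simp
  then show ?case
    by (simp add: poly_var_def mult_single single_add[symmetric])
qed

lemma irrelevant_power_keys:
  fixes g :: "('x \<Rightarrow>\<^sub>0 nat) \<Rightarrow>\<^sub>0 'k::comm_ring_1"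
  assumes "g \<in> irrelevant_ideal V [^]\<^bsub>ideals_set (poly_ring V)\<^esub> k"
  shows "Poly_Mapping.keys g \<subseteq> {m \<in> monomials V. k \<le> monom_degree m}"
  using assms
proof (induction k arbitrary: g)
  case 0
  then show ?case
    by (auto simp: ideals_set_def)
next
  case (Suc k)
  have "ideal {f :: ('x \<Rightarrow>\<^sub>0 nat) \<Rightarrow>\<^sub>0 'k. Poly_Mapping.keys f \<subseteq> {m \<in> monomials V. 1 \<le> monom_degree m}} (poly_ring V)"
    by (rule monomial_ideal) (auto simp: monomials_add_iff monom_degree_add)
  then have irr: "irrelevant_ideal V \<subseteq>
      {f :: ('x \<Rightarrow>\<^sub>0 nat) \<Rightarrow>\<^sub>0 'k. Poly_Mapping.keys f \<subseteq> {m \<in> monomials V. 1 \<le> monom_degree m}}"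
    unfolding irrelevant_ideal_def
    by (intro genideal_poly(3)) (auto simp: poly_var_def single_in_monomials)
  have "g \<in> ideal_prod (poly_ring V) (irrelevant_ideal V [^]\<^bsub>ideals_set (poly_ring V)\<^esub> k) (irrelevant_ideal V)"
    using Suc.prems unfolding ideal_power_Suc .
  then show ?case
  proof (induction rule: ideal_prod.induct)
    case (prod i j)
    then have "Poly_Mapping.keys i \<subseteq> {m \<in> monomials V. k \<le> monom_degree m}"
      "Poly_Mapping.keys j \<subseteq> {m \<in> monomials V. 1 \<le> monom_degree m}"
      using Suc.IH irr by auto
    moreover have "Suc k \<le> a + b" if "k \<le> a" "1 \<le> b" for a b
      using that by simp
    ultimately show ?case
      using keys_mult[of i j] by (fastforce simp: monomials_add_iff monom_degree_add)
  next
    case (sum s t)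
    then show ?case
      using keys_add[of s t] by auto
  qed
qed

text \<open>Over finitely many variables, a polynomial lies in the saturation of an ideal as soon as some
  power of each variable multiplies it into the ideal: a monomial of high degree is divisible by a
  high power of some variable.\<close>

lemma mem_saturation_iff:
  fixes I :: "(('x \<Rightarrow>\<^sub>0 nat) \<Rightarrow>\<^sub>0 'k::comm_ring_1) set"
  assumes V: "finite V" and I: "ideal I (poly_ring V)"
  shows "f \<in> saturation V I \<longleftrightarrow> Poly_Mapping.keys f \<subseteq> monomials V \<and>
    (\<forall>x\<in>V. \<exists>k. Poly_Mapping.single (Poly_Mapping.single x k) 1 * f \<in> I)" (is "_ \<longleftrightarrow> ?R")
proof
  assume "f \<in> saturation V I"
  then show ?R
    using var_power_in_irrelevant_power[where ?'k = 'k] by (fastforce simp: saturation_def)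
next
  assume R: ?R
  then obtain e where e: "\<And>x. x \<in> V \<Longrightarrow> Poly_Mapping.single (Poly_Mapping.single x (e x)) 1 * f \<in> I"
    by metis
  define K where "K = Suc (\<Sum>x\<in>V. e x)"
  have "g * f \<in> I" if g: "g \<in> irrelevant_ideal V [^]\<^bsub>ideals_set (poly_ring V)\<^esub> K" for g
  proof -
    have "Poly_Mapping.single m (Poly_Mapping.lookup g m) * f \<in> I" if m: "m \<in> Poly_Mapping.keys g" for m
    proof -
      have mV: "m \<in> monomials V" "K \<le> monom_degree m"
        using irrelevant_power_keys[OF g] m by auto
      have "\<exists>x\<in>V. e x \<le> Poly_Mapping.lookup m x"
      proof (rule ccontr)
        assume "\<not> (\<exists>x\<in>V. e x \<le> Poly_Mapping.lookup m x)"
        then have "monom_degree m \<le> (\<Sum>x\<in>V. e x)"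
          using mV V by (simp add: monom_degree_superset[of V] monomials_def not_le sum_mono less_imp_le)
        then show False
          using mV by (simp add: K_def)
      qed
      then obtain x n where x: "x \<in> V" and n: "m = Poly_Mapping.single x (e x) + n"
        using monomial_split by metis
      have "Poly_Mapping.single m (Poly_Mapping.lookup g m) * f =
          Poly_Mapping.single n (Poly_Mapping.lookup g m) * (Poly_Mapping.single (Poly_Mapping.single x (e x)) 1 * f)"
        by (simp add: n mult_single add.commute flip: mult.assoc)
      then show ?thesis
        using poly_ideal_monomial_mult[OF I e[OF x]] mV by (simp add: n monomials_add_iff)
    qed
    then have "(\<Sum>m\<in>Poly_Mapping.keys g. Poly_Mapping.single m (Poly_Mapping.lookup g m) * f) \<in> I"
      by (rule poly_ideal_sum[OF I])
    then show ?thesis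
      by (simp add: poly_mapping_sum_single flip: sum_distrib_right)
  qed
  then show "f \<in> saturation V I"
    using R by (auto simp: saturation_def)
qed

section \<open>The toric ideal\<close>

text \<open>The monoid element, with its degree as last coordinate, that is the image of a monomial.\<close>

definition toric_degree :: "('a::euclidean_space \<Rightarrow>\<^sub>0 nat) \<Rightarrow> 'a \<times> real" where
  "toric_degree m = (\<Sum>x\<in>Poly_Mapping.keys m. real (Poly_Mapping.lookup m x) *\<^sub>R (x, 1))"

lemma toric_degree_superset:
  "finite A \<Longrightarrow> Poly_Mapping.keys m \<subseteq> A \<Longrightarrow>
    toric_degree m = (\<Sum>x\<in>A. real (Poly_Mapping.lookup m x) *\<^sub>R (x, 1))"
  unfolding toric_degree_def by (intro sum.mono_neutral_left) (auto simp: in_keys_iff zero_prod_def)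

lemma toric_degree_add: "toric_degree (m + n) = toric_degree m + toric_degree n"
  by (simp only: toric_degree_superset[of "Poly_Mapping.keys m \<union> Poly_Mapping.keys n"] keys_add_nat
      lookup_add of_nat_add scaleR_left_distrib sum.distrib finite_Un finite_keys Un_upper1 Un_upper2
      subset_refl simp_thms)

lemma toric_degree_zero [simp]: "toric_degree 0 = 0"
  by (simp add: toric_degree_def)

lemma toric_degree_single: "toric_degree (Poly_Mapping.single x k) = (real k *\<^sub>R x, real k)"
  by (simp add: toric_degree_def zero_prod_def)

lemma toric_degree_eq:
  assumes "finite A" "Poly_Mapping.keys m \<subseteq> A"
  shows "toric_degree m = (\<Sum>x\<in>A. real (Poly_Mapping.lookup m x) *\<^sub>R x, real (monom_degree m))"
  using assms
  by (simp add: toric_degree_superset[of A] monom_degree_superset[of A] prod_eq_iff fst_sum snd_sum)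

lemma toric_degree_imp_monom_degree_eq:
  "toric_degree m = toric_degree n \<Longrightarrow> monom_degree m = monom_degree n"
  by (simp add: toric_degree_eq[OF finite_keys order_refl])

lemma toric_monom_eq_single: "toric_monom m = Poly_Mapping.single (toric_degree m) 1"
proof -
  have "m \<in> monomials UNIV"
    by (simp add: monomials_def)
  then show ?thesis
  proof (induction m rule: monomials_induct)
    case zero
    show ?case
      by (simp add: toric_monom_def)
  next
    case (add x m)
    then show ?case
      by (simp add: toric_monom_add toric_degree_add mult_single toric_degree_single)
         (simp add: toric_monom_def mult_single)
  qed
qed

lemma toric_map_eq:
  "toric_map f = (\<Sum>m\<in>Poly_Mapping.keys f. Poly_Mapping.single (toric_degree m) (Poly_Mapping.lookup f m))"
  by (simp add: toric_map_def toric_monom_eq_single mult_single)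

lemma lookup_toric_map:
  "Poly_Mapping.lookup (toric_map f) p =
    (\<Sum>m\<in>Poly_Mapping.keys f. if toric_degree m = p then Poly_Mapping.lookup f m else 0)"
  by (simp add: toric_map_eq lookup_sum lookup_single when_def)

lemma mem_toric_ideal_iff:
  "f \<in> toric_ideal P \<longleftrightarrow> Poly_Mapping.keys f \<subseteq> monomials (lattice_points P) \<and> toric_map f = 0"
  by (simp add: toric_ideal_def a_kernel_def')

lemma toric_ideal_ideal:
  "ideal (toric_ideal P :: (_ \<Rightarrow>\<^sub>0 'k::comm_ring_1) set) (poly_ring (lattice_points P))"
proof (rule poly_idealI)
  fix f g :: "_ \<Rightarrow>\<^sub>0 'k"
  assume f: "f \<in> toric_ideal P"
  then show "Poly_Mapping.keys f \<subseteq> monomials (lattice_points P)"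
    by (simp add: mem_toric_ideal_iff)
  show "f + g \<in> toric_ideal P" if "g \<in> toric_ideal P"
    using f that keys_add[of f g] by (auto simp: mem_toric_ideal_iff toric_map_add)
  show "g * f \<in> toric_ideal P" if "Poly_Mapping.keys g \<subseteq> monomials (lattice_points P)"
    using f that keys_mult[of g f] by (auto simp: mem_toric_ideal_iff toric_map_mult monomials_add_iff subset_iff) 
qed (simp add: mem_toric_ideal_iff toric_map_eq)

lemma toric_map_diff: "toric_map (f - g) = toric_map f - toric_map g"
  using toric_map_add[of "f - g" g] by simp

lemma binomial_in_toric_ideal:
  assumes "a \<in> monomials (lattice_points P)" "b \<in> monomials (lattice_points P)"
    and "toric_degree a = toric_degree b"
  shows "Poly_Mapping.single a 1 - Poly_Mapping.single b 1 \<in> toric_ideal P"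
  using assms keys_diff[of "Poly_Mapping.single a 1" "Poly_Mapping.single b 1"]
  by (auto simp: mem_toric_ideal_iff toric_map_diff toric_monom_eq_single split: if_splits)

lemma toric_ideal_partner_monomial:
  assumes f: "f \<in> toric_ideal P" and m: "m \<in> Poly_Mapping.keys f"
  obtains n where "n \<in> Poly_Mapping.keys f" "n \<noteq> m" "toric_degree n = toric_degree m"
proof (rule ccontr)
  assume "\<not> thesis"
  then have "\<And>n. n \<in> Poly_Mapping.keys f \<Longrightarrow> toric_degree n = toric_degree m \<longleftrightarrow> n = m"
    using that by blast
  then have "Poly_Mapping.lookup (toric_map f) (toric_degree m) =
      (\<Sum>n\<in>Poly_Mapping.keys f. if n = m then Poly_Mapping.lookup f n else 0)"
    unfolding lookup_toric_map by (intro sum.cong) auto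
  also have "\<dots> = Poly_Mapping.lookup f m"
    using m by simp
  finally show False
    using f m by (simp add: mem_toric_ideal_iff in_keys_iff)
qed

text \<open>Toric ideals are spanned by binomials.\<close>

lemma toric_ideal_binomial_expansion:
  assumes f: "f \<in> toric_ideal P"
  obtains r where "\<And>m. m \<in> Poly_Mapping.keys f \<Longrightarrow> r m \<in> Poly_Mapping.keys f"
    "\<And>m. m \<in> Poly_Mapping.keys f \<Longrightarrow> toric_degree (r m) = toric_degree m"
    "f = (\<Sum>m\<in>Poly_Mapping.keys f. Poly_Mapping.single 0 (Poly_Mapping.lookup f m) *
            (Poly_Mapping.single m 1 - Poly_Mapping.single (r m) 1))"
proof -
  \<comment> \<open>\<open>r\<close> sends each monomial of \<open>f\<close> to a chosen one with the same image; the coefficients on each fiber sum to zero.\<close>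
  define rep where "rep p = (SOME m. m \<in> Poly_Mapping.keys f \<and> toric_degree m = p)" for p
  define r where "r m = rep (toric_degree m)" for m
  have r: "r m \<in> Poly_Mapping.keys f \<and> toric_degree (r m) = toric_degree m" if "m \<in> Poly_Mapping.keys f" for m
    unfolding r_def rep_def using that by (intro someI_ex[of "\<lambda>n. n \<in> Poly_Mapping.keys f \<and> toric_degree n = toric_degree m"]) auto
  have "(\<Sum>m\<in>Poly_Mapping.keys f. Poly_Mapping.single (r m) (Poly_Mapping.lookup f m)) = 0" (is "?s = 0")
  proof (rule poly_mapping_eqI)
    fix n
    have "Poly_Mapping.lookup ?s n = (\<Sum>m\<in>Poly_Mapping.keys f. if r m = n then Poly_Mapping.lookup f m else 0)"
      by (simp add: lookup_sum lookup_single when_def)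
    also have "\<dots> = (\<Sum>m\<in>Poly_Mapping.keys f. if toric_degree m = toric_degree n \<and> r n = n then Poly_Mapping.lookup f m else 0)"
    proof (intro sum.cong refl if_cong)
      fix m assume "m \<in> Poly_Mapping.keys f"
      then show "r m = n \<longleftrightarrow> toric_degree m = toric_degree n \<and> r n = n"
        using r[of m] by (auto simp: r_def)
    qed
    also have "\<dots> = (if r n = n then Poly_Mapping.lookup (toric_map f) (toric_degree n) else 0)"
      by (simp add: lookup_toric_map)
    finally show "Poly_Mapping.lookup ?s n = Poly_Mapping.lookup 0 n"
      using f by (simp add: mem_toric_ideal_iff)
  qed
  then have "(\<Sum>m\<in>Poly_Mapping.keys f. Poly_Mapping.single 0 (Poly_Mapping.lookup f m) *
            (Poly_Mapping.single m 1 - Poly_Mapping.single (r m) 1)) = f"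
    by (simp add: right_diff_distrib mult_single sum_subtractf poly_mapping_sum_single)
  then show thesis
    using r by (intro that[of r]) auto
qed

text \<open>Monomials map to units of the group algebra of the ambient vector space, so they are nonzerodivisors
  modulo the toric ideal.\<close>

lemma toric_ideal_cancel_monomial:
  assumes "Poly_Mapping.single m 1 * f \<in> toric_ideal P" "Poly_Mapping.keys f \<subseteq> monomials (lattice_points P)"
  shows "f \<in> toric_ideal P"
proof -
  \<comment> \<open>The support of \<open>?g\<close> lies in a group, so the image of the monomial can be inverted there.\<close>
  let ?g = "toric_map f"
  have "Poly_Mapping.single (toric_degree m) 1 * ?g = 0"
    using assms by (simp add: mem_toric_ideal_iff toric_map_mult toric_monom_eq_single)
  then have "Poly_Mapping.single (- toric_degree m) 1 * (Poly_Mapping.single (toric_degree m) 1 * ?g) = 0"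
    by simp
  then have "?g = 0"
    by (simp add: mult_single flip: mult.assoc)
  then show ?thesis
    using assms by (simp add: mem_toric_ideal_iff)
qed

lemma saturation_toric_ideal:
  assumes "finite (lattice_points P)" "lattice_points P \<noteq> {}"
  shows "saturation (lattice_points P) (toric_ideal P) = (toric_ideal P :: (_ \<Rightarrow>\<^sub>0 'k::comm_ring_1) set)"
proof (rule equalityI; rule subsetI)
  fix f :: "_ \<Rightarrow>\<^sub>0 'k"
  assume "f \<in> saturation (lattice_points P) (toric_ideal P)"
  then show "f \<in> toric_ideal P"
    using assms by (auto simp: mem_saturation_iff toric_ideal_ideal intro: toric_ideal_cancel_monomial)
next
  fix f :: "_ \<Rightarrow>\<^sub>0 'k"
  assume "f \<in> toric_ideal P"
  then show "f \<in> saturation (lattice_points P) (toric_ideal P)"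
    using assms by (auto simp: mem_saturation_iff toric_ideal_ideal mem_toric_ideal_iff
        toric_map_mult keys_mult intro!: exI[of _ 0])
qed

section \<open>Necessity of the two conditions\<close>

text \<open>If the toric ideal is scheme-theoretically generated in degree \<open>d\<close> and contains the nonzero binomial
  \<open>X\<^sup>a - X\<^sup>b\<close>, then after multiplication by some power of any variable the first term has a factor \<open>m\<close> of
  degree \<open>d\<close> to which a relation \<open>X\<^sup>m - X\<^sup>m\<^sup>'\<close> of the toric ideal applies nontrivially.  Otherwise no
  generator contains a divisor of that term, and then neither does any element of the ideal.\<close>

lemma scheme_generated_relation_applies:
  fixes P :: "'a::euclidean_space set" and a b :: "'a \<Rightarrow>\<^sub>0 nat"
  defines "V \<equiv> lattice_points P"
  assumes gen: "scheme_theoretically_generated_in_degree d V (toric_ideal P :: (_ \<Rightarrow>\<^sub>0 'k::comm_ring_1) set)"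
    and V: "finite V" "x \<in> V"
    and ab: "a \<in> monomials V" "b \<in> monomials V" "toric_degree a = toric_degree b" "a \<noteq> b"
  obtains k m n m' where "Poly_Mapping.single x k + a = n + m" "monom_degree m = d"
    "m' \<in> monomials V" "m' \<noteq> m" "toric_degree m' = toric_degree m"
proof (rule ccontr)
  assume "\<not> thesis"
  with that have untouched: False
    if "Poly_Mapping.single x k + a = n + m" "monom_degree m = d"
      "m' \<in> monomials V" "m' \<noteq> m" "toric_degree m' = toric_degree m" for k m n m'
    using that by blast
  let ?I = "toric_ideal P :: (('a \<Rightarrow>\<^sub>0 nat) \<Rightarrow>\<^sub>0 'k) set"
  obtain G J where G: "G \<subseteq> carrier (poly_ring V)" "\<And>g. g \<in> G \<Longrightarrow> homogeneous_of_degree d g"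
    and J: "J = Idl\<^bsub>poly_ring V\<^esub> G" "saturation V ?I = saturation V J"
    using gen unfolding scheme_theoretically_generated_in_degree_def by blast
  have ideal: "ideal J (poly_ring V)" "G \<subseteq> J"
    using genideal_poly[OF G(1)] J by auto
  have I: "?I = saturation V J"
    using saturation_toric_ideal[of P, where ?'k = 'k] V J unfolding V_def by auto
  have "G \<subseteq> ?I"
  proof
    fix g assume "g \<in> G"
    then have "g \<in> J"
      using ideal by auto
    then show "g \<in> ?I"
      unfolding I using ideal(1) V poly_ideal_keys[OF ideal(1)]
      by (auto simp: mem_saturation_iff intro!: exI[of _ 0])
  qed
  let ?f = "Poly_Mapping.single a 1 - Poly_Mapping.single b 1 :: ('a \<Rightarrow>\<^sub>0 nat) \<Rightarrow>\<^sub>0 'k"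
  have "?f \<in> saturation V J"
    using binomial_in_toric_ideal ab unfolding V_def I[symmetric, unfolded V_def] by blast
  then obtain k where k: "Poly_Mapping.single (Poly_Mapping.single x k) 1 * ?f \<in> J"
    using V ideal(1) by (auto simp: mem_saturation_iff)
  \<comment> \<open>The polynomials without monomials dividing \<open>\<mu>\<close> form an ideal, which contains the generators.\<close>
  define \<mu> where "\<mu> = Poly_Mapping.single x k + a"
  define U where "U = {m \<in> monomials V. \<nexists>n. \<mu> = n + m}"
  have "ideal {f :: ('a \<Rightarrow>\<^sub>0 nat) \<Rightarrow>\<^sub>0 'k. Poly_Mapping.keys f \<subseteq> U} (poly_ring V)"
    by (rule monomial_ideal) (auto simp: U_def monomials_add_iff simp flip: add.assoc)
  moreover have "G \<subseteq> {f. Poly_Mapping.keys f \<subseteq> U}"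
  proof safe
    fix g m assume g: "g \<in> G" and m: "m \<in> Poly_Mapping.keys g"
    obtain m' where m': "m' \<in> Poly_Mapping.keys g" "m' \<noteq> m" "toric_degree m' = toric_degree m"
      using toric_ideal_partner_monomial[of g P m] g m \<open>G \<subseteq> ?I\<close> by blast
    have "monom_degree m = d" "m \<in> monomials V" "m' \<in> monomials V"
      using G g m m' by (auto simp: homogeneous_of_degree_def)
    then show "m \<in> U"
      using untouched m' unfolding U_def \<mu>_def by blast
  qed
  ultimately have "J \<subseteq> {f. Poly_Mapping.keys f \<subseteq> U}"
    unfolding J(1) by (intro genideal_poly(3) G(1))
  moreover have "Poly_Mapping.lookup (Poly_Mapping.single (Poly_Mapping.single x k) 1 * ?f) \<mu> = 1"
    using ab(4) by (simp add: right_diff_distrib mult_single \<mu>_def lookup_minus lookup_single when_def)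
  then have "\<mu> \<in> Poly_Mapping.keys (Poly_Mapping.single (Poly_Mapping.single x k) 1 * ?f)"
    by (simp add: in_keys_iff)
  ultimately have "\<mu> \<in> U"
    using k by blast
  moreover have "\<mu> = 0 + \<mu>"
    by simp
  ultimately show False
    unfolding U_def by blast
qed

lemma monomial_of_degree_2:
  assumes "monom_degree m = 2"
  obtains y z where "m = Poly_Mapping.single y 1 + Poly_Mapping.single z 1"
proof -
  have split: "\<exists>y n. m = Poly_Mapping.single y 1 + n \<and> monom_degree n = k" if "monom_degree m = Suc k" for m :: "'a \<Rightarrow>\<^sub>0 nat" and k
  proof -
    have "m \<noteq> 0"
      using that by auto
    then obtain y where "y \<in> Poly_Mapping.keys m"
      by fastforce
    then obtain n where "m = Poly_Mapping.single y 1 + n"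
      using monomial_split[of 1 m y] by (auto simp: in_keys_iff)
    then show ?thesis
      using that by (auto simp: monom_degree_add)
  qed
  obtain y n where y: "m = Poly_Mapping.single y 1 + n" "monom_degree n = Suc 0"
    using split[of m 1] assms by (auto simp: numeral_2_eq_2)
  obtain z n' where z: "n = Poly_Mapping.single z 1 + n'" "monom_degree n' = 0"
    using split[OF y(2)] by auto
  then have "n' = 0"
    by (intro poly_mapping_eqI) (simp add: monom_degree_def in_keys_iff)
  then show thesis
    using that[of y z] y z by simp
qed

lemma toric_degree_sum_singles:
  assumes "finite A"
  shows "toric_degree (\<Sum>x\<in>A. Poly_Mapping.single x (c x)) = (\<Sum>x\<in>A. real (c x) *\<^sub>R x, real (\<Sum>x\<in>A. c x))"
  using assms by (induction A) (simp_all add: toric_degree_add toric_degree_single zero_prod_def)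

lemma lookup_sum_singles:
  assumes "finite A"
  shows "Poly_Mapping.lookup (\<Sum>x\<in>A. Poly_Mapping.single x (c x)) y = (if y \<in> A then c y else 0)"
  using assms by (auto simp: lookup_sum lookup_single when_def)

lemma sum_singles_in_monomials:
  "A \<subseteq> V \<Longrightarrow> finite A \<Longrightarrow> (\<Sum>x\<in>A. Poly_Mapping.single x (c x)) \<in> monomials V"
  by (auto simp: monomials_def in_keys_iff lookup_sum_singles split: if_splits)

lemma extreme_point_midpoint:
  assumes "v extreme_point_of P" "y \<in> P" "z \<in> P" "y + z = 2 *\<^sub>R v"
  shows "y = v \<and> z = v"
proof -
  have "v = midpoint y z"
    using assms by (simp add: midpoint_def)
  then have "y = z"
    using assms unfolding extreme_point_of_def by (metis midpoint_in_open_segment)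
  then show ?thesis
    using \<open>v = midpoint y z\<close> by simp
qed

lemma smooth_lattice_polytopeD:
  fixes P :: "'a::euclidean_space set"
  assumes "smooth_lattice_polytope P"
  shows "lattice_polytope P" "polytope P" "convex P" "finite (lattice_points P)"
    "v extreme_point_of P \<Longrightarrow> v \<in> lattice_points P"
  using assms extreme_point_in_int_lattice[of P v]
  by (auto simp: smooth_lattice_polytope_def lattice_polytope_imp_polytope polytope_imp_convex
      finite_lattice_points polytope_imp_bounded extreme_point_of_def)

text \<open>The binomial used has first term \<open>X\<^sub>x X\<^sub>v\<^sup>s\<^sup>-\<^sup>1\<close>, and its second term is the monomial in the neighbors of
  \<open>v\<close> whose exponents are the coordinates of \<open>x\<close> at \<open>v\<close>; it is considered up to powers of \<open>X\<^sub>v\<close>.\<close>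

lemma scheme_generated_imp_vertex_condition:
  fixes P :: "'a::euclidean_space set"
  assumes P: "smooth_lattice_polytope P"
    and gen: "scheme_theoretically_generated_in_degree 2 (lattice_points P)
      (toric_ideal P :: (_ \<Rightarrow>\<^sub>0 'k::comm_ring_1) set)"
    and v: "v extreme_point_of P" and x: "x \<in> lattice_points P" "x \<noteq> v" "x \<notin> neighbors P v"
  shows "\<exists>y \<in> lattice_points (P \<inter> (\<lambda>p. x + v - p) ` P). y \<noteq> v \<and> y \<noteq> x"
proof -
  let ?N = "neighbors P v" and ?V = "lattice_points P"
  note facts = smooth_lattice_polytopeD[OF P]
  have fin: "finite ?N"
    using facts by (simp add: finite_neighbors)
  obtain c :: "'a \<Rightarrow> nat" where c: "x - v = (\<Sum>w\<in>?N. real (c w) *\<^sub>R (w - v))"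
    using lattice_point_vertex_coordinates[OF P v x(1)] .
  define s where "s = (\<Sum>w\<in>?N. c w)"
  have "s \<noteq> 0"
  proof
    assume "s = 0"
    then have "c w = 0" if "w \<in> ?N" for w
      using that fin by (simp add: s_def)
    then show False
      using c x by simp
  qed
  have c': "x - v = (\<Sum>w\<in>?N. real (c w) *\<^sub>R w) - real s *\<^sub>R v"
    by (simp add: c s_def scaleR_diff_right sum_subtractf scaleR_sum_left)
  let ?a = "Poly_Mapping.single x 1 + Poly_Mapping.single v (s - 1)"
  let ?b = "\<Sum>w\<in>?N. Poly_Mapping.single w (c w)"
  have deg: "toric_degree ?a = toric_degree ?b"
    using \<open>s \<noteq> 0\<close> c' fin
    by (simp add: toric_degree_add toric_degree_single toric_degree_sum_singles s_def[symmetric]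
        of_nat_diff algebra_simps)
  have ne: "?a \<noteq> ?b"
  proof
    assume "?a = ?b"
    then have "Poly_Mapping.lookup ?a x = Poly_Mapping.lookup ?b x"
      by simp
    then show False
      using x fin by (simp add: lookup_sum_singles lookup_add)
  qed
  have mon: "?a \<in> monomials ?V" "?b \<in> monomials ?V"
    using x facts(5)[OF v] fin neighbors_subset_lattice_points[of P v]
    by (auto simp: monomials_add_iff single_in_monomials intro: sum_singles_in_monomials)
  obtain k m n m' where m: "Poly_Mapping.single v k + ?a = n + m" "monom_degree m = 2"
    "m' \<in> monomials ?V" "m' \<noteq> m" "toric_degree m' = toric_degree m"
    using scheme_generated_relation_applies[OF gen facts(4) facts(5)[OF v] mon deg ne] .
  obtain p q where pq: "m = Poly_Mapping.single p 1 + Poly_Mapping.single q 1"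
    using monomial_of_degree_2[OF m(2)] .
  have "monom_degree m' = 2"
    using m toric_degree_imp_monom_degree_eq by metis
  then obtain y z where yz: "m' = Poly_Mapping.single y 1 + Poly_Mapping.single z 1"
    using monomial_of_degree_2 by metis
  have yzV: "y \<in> ?V" "z \<in> ?V"
    using m(3) by (auto simp: yz monomials_def keys_add_nat)
  have sum: "y + z = p + q"
    using m(5) by (simp add: yz pq toric_degree_add toric_degree_single)
  \<comment> \<open>\<open>m\<close> divides a product of one \<open>x\<close> and copies of \<open>v\<close>, and it is not \<open>v\<^sup>2\<close> because \<open>v\<close> is extreme.\<close>
  have "p \<in> {x, v}" "q \<in> {x, v}"
    using arg_cong[OF m(1), of Poly_Mapping.keys] by (auto simp: pq keys_add_nat split: if_splits)
  moreover have "\<not> (p = x \<and> q = x)"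
    using arg_cong[OF m(1), of "\<lambda>m. Poly_Mapping.lookup m x"] x(2)
    by (auto simp: pq lookup_add lookup_single)
  moreover have "\<not> (p = v \<and> q = v)"
    using extreme_point_midpoint[OF v, of y z] yzV sum m(4) by (auto simp: pq yz scaleR_2)
  ultimately have "p = x \<and> q = v \<or> p = v \<and> q = x"
    by auto
  then have m_eq: "m = Poly_Mapping.single x 1 + Poly_Mapping.single v 1" and "y + z = x + v"
    using sum by (auto simp: pq add.commute)
  then have y: "y = x + v - z"
    by (simp add: eq_diff_eq)
  have "y \<noteq> v" "y \<noteq> x"
    using m(4) y by (auto simp: m_eq yz add.commute)
  then show ?thesis
    using yzV y by blast
qed

text \<open>The binomial used has first term \<open>X\<^sub>x\<^sup>q\<close>, and its second term is a monomial of degree \<open>q\<close> in the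
  vertices; it is considered up to powers of \<open>X\<^sub>x\<close>.\<close>

lemma scheme_generated_imp_midpoint_condition:
  fixes P :: "'a::euclidean_space set"
  assumes P: "smooth_lattice_polytope P"
    and gen: "scheme_theoretically_generated_in_degree 2 (lattice_points P)
      (toric_ideal P :: (_ \<Rightarrow>\<^sub>0 'k::comm_ring_1) set)"
    and x: "x \<in> lattice_points P" "\<not> x extreme_point_of P"
  shows "\<exists>y \<in> lattice_points P. \<exists>z \<in> lattice_points P. y \<noteq> x \<and> z \<noteq> x \<and> x = midpoint y z"
proof -
  let ?V = "lattice_points P" and ?E = "{u. u extreme_point_of P}"
  note facts = smooth_lattice_polytopeD[OF P]
  have fin: "finite ?E"
    using facts by (simp add: finite_extreme_points)
  obtain q :: nat and c where c: "q > 0" "(\<Sum>u\<in>?E. c u) = q" "(\<Sum>u\<in>?E. real (c u) *\<^sub>R u) = real q *\<^sub>R x"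
    using multiple_is_sum_of_vertices[OF facts(1) x(1)] by metis
  let ?a = "Poly_Mapping.single x q" and ?b = "\<Sum>u\<in>?E. Poly_Mapping.single u (c u)"
  have deg: "toric_degree ?a = toric_degree ?b"
    using c fin by (simp only: toric_degree_single toric_degree_sum_singles)
  have ne: "?a \<noteq> ?b"
  proof
    assume "?a = ?b"
    then have "Poly_Mapping.lookup ?a x = Poly_Mapping.lookup ?b x"
      by simp
    then show False
      using x fin c(1) by (simp add: lookup_sum_singles)
  qed
  have mon: "?a \<in> monomials ?V" "?b \<in> monomials ?V"
    using x fin facts(5) by (auto intro!: single_in_monomials sum_singles_in_monomials)
  obtain k m n m' where m: "Poly_Mapping.single x k + ?a = n + m" "monom_degree m = 2"
    "m' \<in> monomials ?V" "m' \<noteq> m" "toric_degree m' = toric_degree m"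
    using scheme_generated_relation_applies[OF gen facts(4) x(1) mon deg ne] .
  obtain p r where pr: "m = Poly_Mapping.single p 1 + Poly_Mapping.single r 1"
    using monomial_of_degree_2[OF m(2)] .
  have "monom_degree m' = 2"
    using m toric_degree_imp_monom_degree_eq by metis
  then obtain y z where yz: "m' = Poly_Mapping.single y 1 + Poly_Mapping.single z 1"
    using monomial_of_degree_2 by metis
  have yzV: "y \<in> ?V" "z \<in> ?V"
    using m(3) by (auto simp: yz monomials_def keys_add_nat)
  have "p = x" "r = x"
    using arg_cong[OF m(1), of Poly_Mapping.keys] by (auto simp: pr keys_add_nat split: if_splits)
  then have sum: "y + z = 2 *\<^sub>R x" and nx: "\<not> (y = x \<and> z = x)"
    using m(4,5) by (auto simp: yz pr toric_degree_add toric_degree_single scaleR_2)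
  then have "x = midpoint y z"
    by (simp add: midpoint_def)
  moreover have "y \<noteq> x" "z \<noteq> x"
    using sum nx by (auto simp: scaleR_2)
  ultimately show ?thesis
    using yzV by blast
qed

section \<open>Sufficiency of the two conditions\<close>

text \<open>A monomial in a vertex and its neighbors is determined by its image in the monoid, because the
  vectors from the vertex to its neighbors are linearly independent.\<close>

lemma vertex_monomial_unique:
  fixes P :: "'a::euclidean_space set"
  assumes P: "smooth_lattice_polytope P" and v: "v extreme_point_of P"
    and bc: "b \<in> monomials (neighbors P v)" "c \<in> monomials (neighbors P v)"
    and eq: "toric_degree (b + Poly_Mapping.single v i) = toric_degree (c + Poly_Mapping.single v j)"
  shows "b = c" "i = j"
proof -
  let ?N = "neighbors P v"
  have fin: "finite ?N"
    using smooth_lattice_polytopeD[OF P] by (simp add: finite_neighbors)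
  have *: "fst (toric_degree (b + Poly_Mapping.single v i)) - snd (toric_degree (b + Poly_Mapping.single v i)) *\<^sub>R v
      = (\<Sum>w\<in>?N. real (Poly_Mapping.lookup b w) *\<^sub>R (w - v))" if "b \<in> monomials ?N" for b i
    using that fin
    by (simp add: toric_degree_add toric_degree_single toric_degree_eq[of ?N] monomials_def
        monom_degree_superset[of ?N] scaleR_diff_right sum_subtractf scaleR_sum_left scaleR_left_distrib)
  have "Poly_Mapping.lookup b w = Poly_Mapping.lookup c w" if "w \<in> ?N" for w
    using neighbor_coefficients_unique[OF P v _ that, of "\<lambda>w. real (Poly_Mapping.lookup b w)"
        "\<lambda>w. real (Poly_Mapping.lookup c w)"] *[OF bc(1), of i] *[OF bc(2), of j] eq by simp
  moreover have "Poly_Mapping.lookup b w = 0" "Poly_Mapping.lookup c w = 0" if "w \<notin> ?N" for w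
    using bc that by (auto simp: monomials_def in_keys_iff)
  ultimately show "b = c"
    by (intro poly_mapping_eqI) metis
  then show "i = j"
    using toric_degree_imp_monom_degree_eq[OF eq] by (simp add: monom_degree_add)
qed

lemma midpoint_norm_less:
  fixes y z :: "'a::real_inner"
  assumes "y \<noteq> z"
  shows "norm (midpoint y z) < norm y \<or> norm (midpoint y z) < norm z"
proof (rule ccontr)
  assume "\<not> ?thesis"
  then have "norm y ^ 2 \<le> norm (midpoint y z) ^ 2" "norm z ^ 2 \<le> norm (midpoint y z) ^ 2"
    by (auto intro: power_mono)
  moreover have "4 * norm (midpoint y z) ^ 2 + norm (y - z) ^ 2 = 2 * norm y ^ 2 + 2 * norm z ^ 2"
    unfolding midpoint_def power2_norm_eq_inner
    by (simp add: inner_add_left inner_add_right inner_diff_left inner_diff_right inner_commute field_simps)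
  ultimately have "norm (y - z) ^ 2 \<le> 0"
    by linarith
  then show False
    using assms by simp
qed

context
  fixes P :: "'a::euclidean_space set" and J :: "(('a \<Rightarrow>\<^sub>0 nat) \<Rightarrow>\<^sub>0 'k::comm_ring_1) set"
  assumes P: "smooth_lattice_polytope P"
    and J: "ideal J (poly_ring (lattice_points P))" "J \<subseteq> toric_ideal P"
    and quadric: "\<And>a b c d. a \<in> lattice_points P \<Longrightarrow> b \<in> lattice_points P \<Longrightarrow> c \<in> lattice_points P \<Longrightarrow>
      d \<in> lattice_points P \<Longrightarrow> a + b = c + d \<Longrightarrow>
      Poly_Mapping.single (Poly_Mapping.single a 1 + Poly_Mapping.single b 1) 1 -
      Poly_Mapping.single (Poly_Mapping.single c 1 + Poly_Mapping.single d 1) 1 \<in> J"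
begin

private abbreviation (input) V where "V \<equiv> lattice_points P"

text \<open>Congruence of monomials in the lattice points modulo \<open>J\<close>, an ideal between the one generated by the
  quadratic binomials and the toric ideal.\<close>

private definition cong_mon :: "('a \<Rightarrow>\<^sub>0 nat) \<Rightarrow> ('a \<Rightarrow>\<^sub>0 nat) \<Rightarrow> bool" (infix "\<doteq>" 50) where
  "a \<doteq> b \<longleftrightarrow> a \<in> monomials V \<and> b \<in> monomials V \<and> Poly_Mapping.single a 1 - Poly_Mapping.single b 1 \<in> J"

private lemma cong_refl: "a \<in> monomials V \<Longrightarrow> a \<doteq> a"
  by (simp add: cong_mon_def poly_ideal_zero[OF J(1)])

private lemma cong_sym: "a \<doteq> b \<Longrightarrow> b \<doteq> a"
  using poly_ideal_uminus[OF J(1)] by (fastforce simp: cong_mon_def)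

private lemma cong_trans [trans]: "a \<doteq> b \<Longrightarrow> b \<doteq> c \<Longrightarrow> a \<doteq> c"
  using poly_ideal_add[OF J(1)] by (fastforce simp: cong_mon_def)

private lemma cong_add_left: "a \<doteq> b \<Longrightarrow> c \<in> monomials V \<Longrightarrow> c + a \<doteq> c + b"
  using poly_ideal_monomial_mult[OF J(1), of "Poly_Mapping.single a 1 - Poly_Mapping.single b 1" c 1]
  by (simp add: cong_mon_def monomials_add_iff right_diff_distrib mult_single)

private lemma cong_add: "a \<doteq> b \<Longrightarrow> c \<doteq> d \<Longrightarrow> a + c \<doteq> b + d"
  using cong_trans[of "a + c" "a + d" "b + d"] cong_add_left[of c d a] cong_add_left[of a b d]
  by (simp add: cong_mon_def add.commute)

private lemma cong_toric_degree:
  assumes "a \<doteq> b"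
  shows "toric_degree a = toric_degree b"
proof -
  have "Poly_Mapping.single (toric_degree a) (1::'k) = Poly_Mapping.single (toric_degree b) 1"
    using assms J(2) by (auto simp: cong_mon_def mem_toric_ideal_iff toric_map_diff toric_monom_eq_single)
  then have "Poly_Mapping.keys (Poly_Mapping.single (toric_degree a) (1::'k)) =
      Poly_Mapping.keys (Poly_Mapping.single (toric_degree b) (1::'k))"
    by simp
  then show ?thesis
    by simp
qed

private lemma cong_quadric:
  "a \<in> V \<Longrightarrow> b \<in> V \<Longrightarrow> c \<in> V \<Longrightarrow> d \<in> V \<Longrightarrow> a + b = c + d \<Longrightarrow>
    Poly_Mapping.single a 1 + Poly_Mapping.single b 1 \<doteq> Poly_Mapping.single c 1 + Poly_Mapping.single d 1"
  using quadric by (simp add: cong_mon_def monomials_add_iff single_in_monomials)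

text \<open>Modulo \<open>J\<close> and up to powers of \<open>X\<^sub>v\<close>, every variable is a monomial in the neighbors of \<open>v\<close>, by
  induction on the height over \<open>v\<close>.\<close>

private lemma variable_normal_form:
  assumes v: "v extreme_point_of P"
    and cond: "\<And>x. x \<in> V \<Longrightarrow> x \<noteq> v \<Longrightarrow> x \<notin> neighbors P v \<Longrightarrow>
      \<exists>y \<in> lattice_points (P \<inter> (\<lambda>p. x + v - p) ` P). y \<noteq> v \<and> y \<noteq> x"
    and y: "y \<in> V"
  shows "\<exists>k n b. b \<in> monomials (neighbors P v) \<and>
    Poly_Mapping.single y 1 + Poly_Mapping.single v k \<doteq> b + Poly_Mapping.single v n"
proof -
  note facts = smooth_lattice_polytopeD[OF P]
  have vV: "v \<in> V"
    using facts(5)[OF v] .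
  obtain h :: "'a \<Rightarrow> real" where h: "linear h"
      "\<And>y. y \<in> V \<Longrightarrow> h (y - v) \<in> \<nat>" "\<And>y. y \<in> V \<Longrightarrow> y \<noteq> v \<Longrightarrow> h (y - v) \<ge> 1"
    using vertex_height_exists[OF P v] by metis
  obtain i where "h (y - v) = real i"
    using h(2)[OF y] by (auto elim: Nats_cases)
  then show ?thesis
    using y
  proof (induction i arbitrary: y rule: less_induct)
    case (less i y)
    consider "y = v" | "y \<in> neighbors P v" | "y \<noteq> v" "y \<notin> neighbors P v"
      by blast
    then show ?case
    proof cases
      case 1
      then show ?thesis
        using vV by (intro exI[of _ 0] exI[of _ 1] exI[of _ "0 :: 'a \<Rightarrow>\<^sub>0 nat"])
          (simp add: cong_refl single_in_monomials)
    next
      case 2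
      then show ?thesis
        using less.prems by (intro exI[of _ 0] exI[of _ "Poly_Mapping.single y 1"])
          (simp add: cong_refl single_in_monomials)
    next
      case 3
      then obtain z u where z: "z \<in> V" "z \<noteq> v" "z \<noteq> y" and u: "u \<in> P" "z = y + v - u"
        using cond[OF less.prems(2) 3] by auto
      have u': "u = y + v - z"
        using u by simp
      have uV: "u \<in> V" "u \<noteq> v"
        using u z less.prems vV unfolding u' by (auto intro!: int_lattice_diff int_lattice_add)
      have "(z - v) + (u - v) = y - v"
        by (simp add: u')
      then have sum: "h (z - v) + h (u - v) = real i"
        using less.prems(1) linear_add[OF h(1), of "z - v" "u - v"] by metis
      obtain iz iu where iz: "h (z - v) = real iz" and iu: "h (u - v) = real iu"
        using h(2)[OF z(1)] h(2)[OF uV(1)] by (auto elim!: Nats_cases)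
      have "iz < i" "iu < i"
        using sum h(3)[OF z(1,2)] h(3)[OF uV] iz iu by linarith+
      then obtain k k' n n' b b' where
        b: "b \<in> monomials (neighbors P v)"
          "Poly_Mapping.single z 1 + Poly_Mapping.single v k \<doteq> b + Poly_Mapping.single v n" and
        b': "b' \<in> monomials (neighbors P v)"
          "Poly_Mapping.single u 1 + Poly_Mapping.single v k' \<doteq> b' + Poly_Mapping.single v n'"
        using less.IH iz iu z(1) uV(1) by metis
      have "Poly_Mapping.single v (Suc (k + k')) = Poly_Mapping.single v (k + k') + Poly_Mapping.single v 1"
        by (simp flip: single_add)
      then have "Poly_Mapping.single y 1 + Poly_Mapping.single v (Suc (k + k')) =
          Poly_Mapping.single v (k + k') + (Poly_Mapping.single y 1 + Poly_Mapping.single v 1)"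
        by (simp add: ac_simps)
      also have "\<dots> \<doteq> Poly_Mapping.single v (k + k') + (Poly_Mapping.single z 1 + Poly_Mapping.single u 1)"
        using z uV vV less.prems u' by (intro cong_add_left cong_quadric single_in_monomials) auto
      also have "\<dots> = (Poly_Mapping.single z 1 + Poly_Mapping.single v k) + (Poly_Mapping.single u 1 + Poly_Mapping.single v k')"
        by (simp add: ac_simps single_add)
      also have "\<dots> \<doteq> (b + Poly_Mapping.single v n) + (b' + Poly_Mapping.single v n')"
        by (intro cong_add b b')
      also have "\<dots> = (b + b') + Poly_Mapping.single v (n + n')"
        by (simp add: ac_simps single_add)
      finally show ?thesis
        using b b' monomials_add_iff by blast
    qed
  qed
qed

private lemma monomial_normal_form:
  assumes v: "v extreme_point_of P"
    and cond: "\<And>x. x \<in> V \<Longrightarrow> x \<noteq> v \<Longrightarrow> x \<notin> neighbors P v \<Longrightarrow>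
      \<exists>y \<in> lattice_points (P \<inter> (\<lambda>p. x + v - p) ` P). y \<noteq> v \<and> y \<noteq> x"
    and m: "m \<in> monomials V"
  shows "\<exists>k n b. b \<in> monomials (neighbors P v) \<and>
    m + Poly_Mapping.single v k \<doteq> b + Poly_Mapping.single v n"
  using m
proof (induction m rule: monomials_induct)
  case zero
  then show ?case
    by (intro exI[of _ 0]) (simp add: cong_refl)
next
  case (add x m)
  obtain k k' n n' b b' where
    b: "b \<in> monomials (neighbors P v)"
      "Poly_Mapping.single x 1 + Poly_Mapping.single v k \<doteq> b + Poly_Mapping.single v n" and
    b': "b' \<in> monomials (neighbors P v)"
      "m + Poly_Mapping.single v k' \<doteq> b' + Poly_Mapping.single v n'"
    using variable_normal_form[OF v cond add(1)] add(3) by metis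
  have "(Poly_Mapping.single x 1 + m) + Poly_Mapping.single v (k + k') =
      (Poly_Mapping.single x 1 + Poly_Mapping.single v k) + (m + Poly_Mapping.single v k')"
    by (simp add: ac_simps single_add)
  also have "\<dots> \<doteq> (b + Poly_Mapping.single v n) + (b' + Poly_Mapping.single v n')"
    by (intro cong_add b b')
  also have "\<dots> = (b + b') + Poly_Mapping.single v (n + n')"
    by (simp add: ac_simps single_add)
  finally show ?case
    using b b' monomials_add_iff by blast
qed

private lemma cong_after_vertex_power:
  assumes v: "v extreme_point_of P"
    and cond: "\<And>x. x \<in> V \<Longrightarrow> x \<noteq> v \<Longrightarrow> x \<notin> neighbors P v \<Longrightarrow>
      \<exists>y \<in> lattice_points (P \<inter> (\<lambda>p. x + v - p) ` P). y \<noteq> v \<and> y \<noteq> x"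
    and m: "m \<in> monomials V" "m' \<in> monomials V" "toric_degree m = toric_degree m'"
  shows "\<exists>k. Poly_Mapping.single v k + m \<doteq> Poly_Mapping.single v k + m'"
proof -
  have vV: "v \<in> V"
    using smooth_lattice_polytopeD(5)[OF P v] .
  obtain k k' n n' b b' where
    b: "b \<in> monomials (neighbors P v)" "m + Poly_Mapping.single v k \<doteq> b + Poly_Mapping.single v n" and
    b': "b' \<in> monomials (neighbors P v)" "m' + Poly_Mapping.single v k' \<doteq> b' + Poly_Mapping.single v n'"
    using monomial_normal_form[OF v cond m(1)] monomial_normal_form[OF v cond m(2)] by metis
  have 1: "Poly_Mapping.single v (k + k') + m \<doteq> b + Poly_Mapping.single v (n + k')"
    using cong_add_left[OF b(2) single_in_monomials[OF vV, of k']] by (simp add: single_add ac_simps)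
  have 2: "Poly_Mapping.single v (k + k') + m' \<doteq> b' + Poly_Mapping.single v (n' + k)"
    using cong_add_left[OF b'(2) single_in_monomials[OF vV, of k]] by (simp add: single_add ac_simps)
  have "toric_degree (b + Poly_Mapping.single v (n + k')) = toric_degree (b' + Poly_Mapping.single v (n' + k))"
    using cong_toric_degree[OF 1] cong_toric_degree[OF 2] m(3) by (simp add: toric_degree_add)
  then have "b = b'" "n + k' = n' + k"
    using vertex_monomial_unique[OF P v b(1) b'(1)] by blast+
  then have "b + Poly_Mapping.single v (n + k') \<doteq> Poly_Mapping.single v (k + k') + m'"
    using cong_sym[OF 2] by simp
  then show ?thesis
    using cong_trans[OF 1] by blast
qed

text \<open>The induction goes up in the norm: of two distinct points with midpoint \<open>x\<close>, one is farther from the origin than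
  \<open>x\<close>.\<close>

private lemma power_divisible_by_vertex:
  assumes cond: "\<And>x. x \<in> V \<Longrightarrow> \<not> x extreme_point_of P \<Longrightarrow>
      \<exists>y \<in> V. \<exists>z \<in> V. y \<noteq> x \<and> z \<noteq> x \<and> x = midpoint y z"
    and x: "x \<in> V"
  shows "\<exists>v k s. v extreme_point_of P \<and> Poly_Mapping.single x k \<doteq> Poly_Mapping.single v 1 + s"
  using x
proof (induction "card {y \<in> V. norm x < norm y}" arbitrary: x rule: less_induct)
  case less
  show ?case
  proof (cases "x extreme_point_of P")
    case True
    then show ?thesis
      using less.prems by (intro exI[of _ x] exI[of _ 1] exI[of _ 0]) (simp add: cong_refl single_in_monomials)
  next
    case False
    then obtain y' z' where yz': "y' \<in> V" "z' \<in> V" "y' \<noteq> x" "x = midpoint y' z'"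
      using cond[OF less.prems] by blast
    have "y' \<noteq> z'"
      using yz' by auto
    then have "norm x < norm y' \<or> norm x < norm z'"
      using yz'(4) midpoint_norm_less[of y' z'] by simp
    with yz' obtain y z where yz: "y \<in> V" "z \<in> V" "x = midpoint y z" "norm x < norm y"
      by (metis midpoint_sym)
    have "{u \<in> V. norm y < norm u} \<subset> {u \<in> V. norm x < norm u}"
      using yz by auto
    then have "card {u \<in> V. norm y < norm u} < card {u \<in> V. norm x < norm u}"
      using finite_subset[OF _ smooth_lattice_polytopeD(4)[OF P], of "{u \<in> V. norm x < norm u}"]
      by (intro psubset_card_mono) auto
    then obtain v k s where v: "v extreme_point_of P" "Poly_Mapping.single y k \<doteq> Poly_Mapping.single v 1 + s"
      using less.hyps yz(1) by blast
    have "x + x = y + z"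
      using yz(3) by (simp add: midpoint_def flip: scaleR_2)
    then have "Poly_Mapping.single x 1 + Poly_Mapping.single x 1 \<doteq> Poly_Mapping.single y 1 + Poly_Mapping.single z 1"
      using yz less.prems by (intro cong_quadric)
    then have "Poly_Mapping.single x (2 * j) \<doteq> Poly_Mapping.single y j + Poly_Mapping.single z j" for j
    proof (induction j)
      case (Suc j)
      have "Poly_Mapping.single x (2 * Suc j) =
          (Poly_Mapping.single x 1 + Poly_Mapping.single x 1) + Poly_Mapping.single x (2 * j)"
        by (simp flip: single_add)
      also have "\<dots> \<doteq> (Poly_Mapping.single y 1 + Poly_Mapping.single z 1) + (Poly_Mapping.single y j + Poly_Mapping.single z j)"
        by (intro cong_add Suc.prems Suc.IH[OF Suc.prems])
      also have "\<dots> = (Poly_Mapping.single y 1 + Poly_Mapping.single y j) + (Poly_Mapping.single z 1 + Poly_Mapping.single z j)"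
        by (simp add: ac_simps)
      finally show ?case
        by (simp flip: single_add)
    qed (simp add: cong_refl)
    then have "Poly_Mapping.single x (2 * k) \<doteq> Poly_Mapping.single y k + Poly_Mapping.single z k" .
    also have "\<dots> \<doteq> (Poly_Mapping.single v 1 + s) + Poly_Mapping.single z k"
      using v yz by (intro cong_add cong_refl single_in_monomials)
    finally show ?thesis
      using v(1) by (metis add.assoc)
  qed
qed

text \<open>Inverting \<open>X\<^sub>x\<close> inverts the variable of a vertex \<open>v\<close>, since \<open>X\<^sub>v\<close> divides a power of \<open>X\<^sub>x\<close> modulo \<open>J\<close>; this
  reduces the claim to \<open>v\<close>.\<close>

lemma cong_after_variable_power:
  assumes vertex_cond: "\<And>v x. v extreme_point_of P \<Longrightarrow> x \<in> V \<Longrightarrow> x \<noteq> v \<Longrightarrow> x \<notin> neighbors P v \<Longrightarrow>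
      \<exists>y \<in> lattice_points (P \<inter> (\<lambda>p. x + v - p) ` P). y \<noteq> v \<and> y \<noteq> x"
    and midpoint_cond: "\<And>x. x \<in> V \<Longrightarrow> \<not> x extreme_point_of P \<Longrightarrow>
      \<exists>y \<in> V. \<exists>z \<in> V. y \<noteq> x \<and> z \<noteq> x \<and> x = midpoint y z"
    and x: "x \<in> V" and m: "m \<in> monomials V" "m' \<in> monomials V" "toric_degree m = toric_degree m'"
  shows "\<exists>k. Poly_Mapping.single (Poly_Mapping.single x k) 1 *
    (Poly_Mapping.single m 1 - Poly_Mapping.single m' 1) \<in> J"
proof -
  obtain v k s where v: "v extreme_point_of P" and xs: "Poly_Mapping.single x k \<doteq> Poly_Mapping.single v 1 + s"
    using power_divisible_by_vertex[OF midpoint_cond x] by blast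
  obtain j where j: "Poly_Mapping.single v j + m \<doteq> Poly_Mapping.single v j + m'"
    using cong_after_vertex_power[OF v vertex_cond[OF v] m] by blast
  have "\<exists>t. Poly_Mapping.single x (k * i) \<doteq> Poly_Mapping.single v i + t" for i
  proof (induction i)
    case 0
    then show ?case
      by (intro exI[of _ 0]) (simp add: cong_refl)
  next
    case (Suc i)
    then obtain t where t: "Poly_Mapping.single x (k * i) \<doteq> Poly_Mapping.single v i + t"
      by blast
    have xi: "Poly_Mapping.single x (k * Suc i) = Poly_Mapping.single x k + Poly_Mapping.single x (k * i)"
      and vi: "Poly_Mapping.single v (Suc i) = Poly_Mapping.single v 1 + Poly_Mapping.single v i"
      by (simp_all flip: single_add)
    from cong_add[OF xs t] have "Poly_Mapping.single x (k * Suc i) \<doteq> Poly_Mapping.single v (Suc i) + (s + t)"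
      using xi vi by (simp add: ac_simps)
    then show ?case
      by blast
  qed
  then obtain t where t: "Poly_Mapping.single x (k * j) \<doteq> Poly_Mapping.single v j + t"
    by blast
  then have tV: "t \<in> monomials V"
    by (simp add: cong_mon_def monomials_add_iff)
  have *: "Poly_Mapping.single x (k * j) + n \<doteq> t + (Poly_Mapping.single v j + n)" if "n \<in> monomials V" for n
    using cong_add_left[OF t that] by (simp add: ac_simps)
  have "Poly_Mapping.single x (k * j) + m \<doteq> Poly_Mapping.single x (k * j) + m'"
    using *[OF m(1)] cong_add_left[OF j tV] cong_sym[OF *[OF m(2)]] cong_trans by blast
  then show ?thesis
    by (intro exI[of _ "k * j"]) (simp add: cong_mon_def right_diff_distrib mult_single)
qed

end

lemma conditions_imp_scheme_generated:
  fixes P :: "'a::euclidean_space set"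
  assumes P: "smooth_lattice_polytope P"
    and vertex_cond: "\<And>v x. v extreme_point_of P \<Longrightarrow> x \<in> lattice_points P \<Longrightarrow> x \<noteq> v \<Longrightarrow> x \<notin> neighbors P v \<Longrightarrow>
      \<exists>y \<in> lattice_points (P \<inter> (\<lambda>p. x + v - p) ` P). y \<noteq> v \<and> y \<noteq> x"
    and midpoint_cond: "\<And>x. x \<in> lattice_points P \<Longrightarrow> \<not> x extreme_point_of P \<Longrightarrow>
      \<exists>y \<in> lattice_points P. \<exists>z \<in> lattice_points P. y \<noteq> x \<and> z \<noteq> x \<and> x = midpoint y z"
  shows "scheme_theoretically_generated_in_degree 2 (lattice_points P)
      (toric_ideal P :: (_ \<Rightarrow>\<^sub>0 'k::comm_ring_1) set)"
proof -
  let ?V = "lattice_points P" and ?I = "toric_ideal P :: (('a \<Rightarrow>\<^sub>0 nat) \<Rightarrow>\<^sub>0 'k) set"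
  define G where "G = {g \<in> ?I. homogeneous_of_degree 2 g}"
  define J where "J = Idl\<^bsub>poly_ring ?V\<^esub> G"
  note facts = smooth_lattice_polytopeD[OF P]
  have G: "G \<subseteq> carrier (poly_ring ?V)"
    by (auto simp: G_def mem_toric_ideal_iff)
  have J: "ideal J (poly_ring ?V)" "G \<subseteq> J" "J \<subseteq> ?I"
    using genideal_poly[OF G] toric_ideal_ideal unfolding J_def by (auto simp: G_def)
  have "?V \<noteq> {}"
  proof
    assume "?V = {}"
    then have "{v. v extreme_point_of P} = {}"
      using facts(5) by blast
    then have "P = {}"
      using polytope_eq_hull_extreme_points[OF facts(2)] by simp
    then show False
      using P by (simp add: smooth_lattice_polytope_def)
  qed
  have quadric: "Poly_Mapping.single (Poly_Mapping.single a 1 + Poly_Mapping.single b 1) 1 -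
      Poly_Mapping.single (Poly_Mapping.single c 1 + Poly_Mapping.single d 1) 1 \<in> J"
    if "a \<in> ?V" "b \<in> ?V" "c \<in> ?V" "d \<in> ?V" "a + b = c + d" for a b c d
  proof -
    let ?m = "Poly_Mapping.single a 1 + Poly_Mapping.single b (1::nat)"
    let ?n = "Poly_Mapping.single c 1 + Poly_Mapping.single d (1::nat)"
    let ?g = "Poly_Mapping.single ?m 1 - Poly_Mapping.single ?n 1 :: ('a \<Rightarrow>\<^sub>0 nat) \<Rightarrow>\<^sub>0 'k"
    have "?g \<in> ?I"
      using that by (intro binomial_in_toric_ideal)
        (auto simp: monomials_add_iff single_in_monomials toric_degree_add toric_degree_single)
    moreover have "Poly_Mapping.keys ?g \<subseteq> {?m, ?n}"
      using keys_diff[of "Poly_Mapping.single ?m (1::'k)" "Poly_Mapping.single ?n 1"] by auto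
    then have "homogeneous_of_degree 2 ?g"
      by (auto simp: homogeneous_of_degree_def monom_degree_add dest!: subsetD)
    ultimately show ?thesis
      using J(2) by (auto simp: G_def)
  qed
  have "f \<in> saturation ?V J" if f: "f \<in> ?I" for f
  proof -
    have keys: "Poly_Mapping.keys f \<subseteq> monomials ?V"
      using f by (simp add: mem_toric_ideal_iff)
    obtain r where r: "\<And>m. m \<in> Poly_Mapping.keys f \<Longrightarrow> r m \<in> Poly_Mapping.keys f"
      "\<And>m. m \<in> Poly_Mapping.keys f \<Longrightarrow> toric_degree (r m) = toric_degree m"
      "f = (\<Sum>m\<in>Poly_Mapping.keys f. Poly_Mapping.single 0 (Poly_Mapping.lookup f m) *
            (Poly_Mapping.single m 1 - Poly_Mapping.single (r m) 1))"
      using toric_ideal_binomial_expansion[OF f] by blast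
    have "\<exists>K. Poly_Mapping.single (Poly_Mapping.single x K) 1 * f \<in> J" if x: "x \<in> ?V" for x
    proof -
      have "\<exists>k. Poly_Mapping.single (Poly_Mapping.single x k) 1 *
          (Poly_Mapping.single m 1 - Poly_Mapping.single (r m) 1) \<in> J" if "m \<in> Poly_Mapping.keys f" for m
        using r that keys
        by (intro cong_after_variable_power[OF P J(1,3) quadric vertex_cond midpoint_cond x]) auto
      then obtain k where k: "\<And>m. m \<in> Poly_Mapping.keys f \<Longrightarrow> Poly_Mapping.single (Poly_Mapping.single x (k m)) 1 *
          (Poly_Mapping.single m 1 - Poly_Mapping.single (r m) 1) \<in> J"
        by metis
      define K where "K = (\<Sum>m\<in>Poly_Mapping.keys f. k m)"
      have "Poly_Mapping.single (Poly_Mapping.single x K) 1 *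
          (Poly_Mapping.single 0 (Poly_Mapping.lookup f m) *
            (Poly_Mapping.single m 1 - Poly_Mapping.single (r m) 1)) \<in> J" (is "?p \<in> J")
        if m: "m \<in> Poly_Mapping.keys f" for m
      proof -
        have "k m \<le> K"
          unfolding K_def by (intro member_le_sum m) auto
        then have "?p = Poly_Mapping.single (Poly_Mapping.single x (K - k m)) (Poly_Mapping.lookup f m) *
            (Poly_Mapping.single (Poly_Mapping.single x (k m)) 1 *
              (Poly_Mapping.single m 1 - Poly_Mapping.single (r m) 1))"
          by (simp add: mult_single flip: mult.assoc single_add)
        then show ?thesis
          using poly_ideal_monomial_mult[OF J(1) k[OF m] single_in_monomials[OF x]] by simp
      qed
      then have "Poly_Mapping.single (Poly_Mapping.single x K) 1 * f \<in> J"
        by (subst r(3)) (auto simp: sum_distrib_left intro: poly_ideal_sum[OF J(1)])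
      then show ?thesis
        by blast
    qed
    then show ?thesis
      using keys by (simp add: mem_saturation_iff[OF facts(4) J(1)])
  qed
  moreover have "saturation ?V J \<subseteq> saturation ?V ?I"
    using J(3) mem_saturation_iff[OF facts(4) J(1)] mem_saturation_iff[OF facts(4) toric_ideal_ideal] by blast
  ultimately have "saturation ?V ?I = saturation ?V J"
    using saturation_toric_ideal[OF facts(4) \<open>?V \<noteq> {}\<close>, where ?'k = 'k] by blast
  then show ?thesis
    unfolding scheme_theoretically_generated_in_degree_def J_def
    using G by (intro exI[of _ G] exI[of _ "Idl\<^bsub>poly_ring ?V\<^esub> G"]) (auto simp: G_def)
qed

theorem theorem5p1:
  fixes P :: "(real ^ 'n) set"
  assumes "smooth_lattice_polytope P"
  shows "scheme_theoretically_generated_in_degree 2 (lattice_points P)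
           (toric_ideal P :: (((real ^ 'n) \<Rightarrow>\<^sub>0 nat) \<Rightarrow>\<^sub>0 'k::field) set)
         \<longleftrightarrow>
         (\<forall>v x. v extreme_point_of P \<and> x \<in> lattice_points P \<and> x \<noteq> v \<and> x \<notin> neighbors P v \<longrightarrow>
            (\<exists>y \<in> lattice_points (P \<inter> (\<lambda>p. x + v - p) ` P). y \<noteq> v \<and> y \<noteq> x)) \<and>
         (\<forall>x \<in> lattice_points P. \<not> x extreme_point_of P \<longrightarrow>
            (\<exists>y \<in> lattice_points P. \<exists>z \<in> lattice_points P.
               y \<noteq> x \<and> z \<noteq> x \<and> x = midpoint y z))"
    (is "?gen \<longleftrightarrow> ?a \<and> ?b")
proof
  assume gen: ?gen
  show "?a \<and> ?b"
    using scheme_generated_imp_vertex_condition[OF assms gen]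
      scheme_generated_imp_midpoint_condition[OF assms gen] by blast
next
  assume *: "?a \<and> ?b"
  show ?gen
  proof (rule conditions_imp_scheme_generated[OF assms])
    fix v x
    assume "v extreme_point_of P" "x \<in> lattice_points P" "x \<noteq> v" "x \<notin> neighbors P v"
    then show "\<exists>y \<in> lattice_points (P \<inter> (\<lambda>p. x + v - p) ` P). y \<noteq> v \<and> y \<noteq> x"
      using * by blast
  next
    fix x assume "x \<in> lattice_points P" "\<not> x extreme_point_of P"
    then show "\<exists>y \<in> lattice_points P. \<exists>z \<in> lattice_points P. y \<noteq> x \<and> z \<noteq> x \<and> x = midpoint y z"
      using * by blast
  qed
qed

end
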